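(* Let $$\mathcal P_i=\{S_{\alpha,\beta}:\alpha,\beta\in\mathbb Z[i],\ \alpha,\beta\text{ relatively prime in }\mathbb Z[i]\},$$ $$\mathcal B_i=\{\langle a+m/\sqrt3,\ b+m/\sqrt3,\ c+m/\sqrt3\rangle:(a,b,c)\in\mathcal S,\ a+b+c>0,\ m=\pm\sqrt{ab+ac+bc}\},$$ where $\mathcal S=\{(a,b,c)\in\mathbb Z^3:\gcd(a,b,c)=1,\ \sqrt{ab+ac+bc}\in\mathbb Z\}$, and let $\mathcal G_i$ be the set of spheres generated from $\{S_{0,1},S_{1,1},S_{1,0}\}$ by the octahedral procedure described in the context. Let $\omega=(-1+i\sqrt3)/2$ and let $M$ be (the Poincaré extension of) the Möbius transformation $M(z)=\frac{iz}{(1-z)\omega}$. Then $$\mathcal G_i=\mathcal P_i=M(\mathcal B_i).$$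
   Context: Identify $\mathbb R^3$ with $\mathbb C\times\mathbb R$. For $z\in\mathbb C$, $r>0$, $S(z,r)$ is the sphere with center $(z,r)$ and radius $r$, tangent to $\mathbb C$ at $z$ (a normal sphere). For $\alpha,\beta\in\mathbb C$, $\beta\ne0$, $S_{\alpha,\beta}:=S\left(\frac\alpha\beta,\frac1{2|\beta|^2}\right)$; for $|\alpha|=1$, $S_{\alpha,0}=S_{1,0}$ is the plane $\mathbb C\times\{1\}$. Planes $\mathbb C\times\{h\}$, $h>0$, are regarded as normal spheres tangent at $\infty$. For real $a,b,c$ with $a+b+c>0$, $$\langle a,b,c\rangle:=S\left(\frac{b+c(1+\omega)}{a+b+c},\frac1{2(a+b+c)}\right).$$ The Poincaré extension of a Möbius transformation $f$ (the continuous sphere-preserving extension to the upper half space) sends $S(z,r)$ to $S(f(z),|f'(z)|r)$ when $f(z)\neq\infty$; the extension of the Möbius transformation $M(z)=\frac{iz}{(1-z)\omega}$, where $\omega=(-1+i\sqrt3)/2$, sends $S(1,r)$ to the plane $\mathbb C\times\{1/(2r)\}$. Tangency: $S(z,r)$ and $S(w,s)$ with $z\ne w$ are tangent iff $|z-w|^2=4rs$; the plane $\mathbb C\times\{h\}$ is tangent to $S(z,r)$ iff $h=2r$; distinct planes are not tangent. The contact graph of a finite collection of spheres has the spheres as vertices, with tangent spheres adjacent. Octahedral procedure: given three mutually tangent normal spheres (planes allowed), there are exactly two sets of three further mutually tangent normal spheres (planes allowed) such that the six spheres have contact graph the edge graph of an octahedron. Start with $\mathcal S_0=\{S_{0,1},S_{1,1},S_{1,0}\}$;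 given $\mathcal S_n$, choose three mutually tangent members of it and form $\mathcal S_{n+1}$ by adding the three spheres of one of these two sets. $\mathcal G_i$ is the union of all sets in all such chains $\mathcal S_0\subset\mathcal S_1\subset\cdots$. *)

theory Defs
  imports "HOL-Analysis.Analysis"
begin

text \<open>Euclidean 3-space is \<^typ>\<open>complex \<times> real\<close>, and spheres are subsets of it. A normal sphere is
  either a sphere in the closed upper half space tangent to \<open>\<complex> \<times> {0}\<close>, or a horizontal plane
  above \<open>\<complex> \<times> {0}\<close>, regarded as tangent to it at infinity.\<close>

definition Sph :: "complex \<Rightarrow> real \<Rightarrow> (complex \<times> real) set" where
  "Sph z r = sphere (z, r) r"

definition Plane :: "real \<Rightarrow> (complex \<times> real) set" where
  "Plane h = UNIV \<times> {h}"

definition normal_sphere :: "(complex \<times> real) set \<Rightarrow> bool" where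
  "normal_sphere X \<longleftrightarrow> (\<exists>z r. r > 0 \<and> X = Sph z r) \<or> (\<exists>h. h > 0 \<and> X = Plane h)"

text \<open>Two distinct spheres touching \<open>\<complex>\<close> at the same point do not count as tangent, just as two
  distinct planes do not (they touch at infinity).\<close>

definition tangent :: "(complex \<times> real) set \<Rightarrow> (complex \<times> real) set \<Rightarrow> bool" where
  "tangent X Y \<longleftrightarrow>
     (\<exists>z w r s. r > 0 \<and> s > 0 \<and> z \<noteq> w \<and> X = Sph z r \<and> Y = Sph w s \<and> (norm (z - w))\<^sup>2 = 4 * r * s) \<or>
     (\<exists>z r h. r > 0 \<and> h > 0 \<and> (X = Plane h \<and> Y = Sph z r \<or> X = Sph z r \<and> Y = Plane h) \<and> h = 2 * r)"


text \<open>The plane is the value of \<open>S\<^bsub>\<alpha>,\<beta>\<^esub>\<close> at \<open>\<beta> = 0\<close>; there it is meant only for \<open>\<bar>\<alpha>\<bar> = 1\<close>.\<close>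

definition Sab :: "complex \<Rightarrow> complex \<Rightarrow> (complex \<times> real) set" where
  "Sab \<alpha> \<beta> = (if \<beta> = 0 then Plane 1 else Sph (\<alpha> / \<beta>) (1 / (2 * (norm \<beta>)\<^sup>2)))"

definition gauss_ints :: "complex set" where
  "gauss_ints = {z. Re z \<in> \<int> \<and> Im z \<in> \<int>}"

definition gauss_dvd :: "complex \<Rightarrow> complex \<Rightarrow> bool" where
  "gauss_dvd \<delta> \<alpha> \<longleftrightarrow> (\<exists>\<kappa>\<in>gauss_ints. \<alpha> = \<delta> * \<kappa>)"

definition gauss_coprime :: "complex \<Rightarrow> complex \<Rightarrow> bool" where
  "gauss_coprime \<alpha> \<beta> \<longleftrightarrow>
     (\<forall>\<delta>\<in>gauss_ints. gauss_dvd \<delta> \<alpha> \<longrightarrow> gauss_dvd \<delta> \<beta> \<longrightarrow> gauss_dvd \<delta> 1)"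

definition P_i :: "(complex \<times> real) set set" where
  "P_i = {Sab \<alpha> \<beta> |\<alpha> \<beta>. \<alpha> \<in> gauss_ints \<and> \<beta> \<in> gauss_ints \<and> gauss_coprime \<alpha> \<beta>}"


definition omega :: complex where
  "omega = (- 1 + \<i> * of_real (sqrt 3)) / 2"

text \<open>Meaningful for \<open>a + b + c > 0\<close> only.\<close>

definition ang :: "real \<Rightarrow> real \<Rightarrow> real \<Rightarrow> (complex \<times> real) set" where
  "ang a b c = Sph ((of_real b + of_real c * (1 + omega)) / of_real (a + b + c))
                   (1 / (2 * (a + b + c)))"

text \<open>The nonnegativity condition is needed because \<^const>\<open>sqrt\<close> is an odd function on the reals,
  so that for instance \<open>sqrt (- 4) = - 2\<close> is an integer.\<close>

definition triples :: "(int \<times> int \<times> int) set" where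
  "triples = {(a, b, c). gcd a (gcd b c) = 1 \<and> a * b + a * c + b * c \<ge> 0 \<and>
                         sqrt (real_of_int (a * b + a * c + b * c)) \<in> \<int>}"

definition B_i :: "(complex \<times> real) set set" where
  "B_i = {ang (real_of_int a + m / sqrt 3) (real_of_int b + m / sqrt 3) (real_of_int c + m / sqrt 3)
           |a b c m. (a, b, c) \<in> triples \<and> a + b + c > 0 \<and>
             (m = sqrt (real_of_int (a * b + a * c + b * c)) \<or>
              m = - sqrt (real_of_int (a * b + a * c + b * c)))}"


text \<open>A simple graph is a vertex set together with a set of two-element edges.\<close>

type_synonym 'v graph = "'v set \<times> 'v set set"

definition graph_iso :: "'v graph \<Rightarrow> 'w graph \<Rightarrow> bool" where
  "graph_iso G H \<longleftrightarrow>
     (\<exists>f. bij_betw f (fst G) (fst H) \<and>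
          (\<forall>x\<in>fst G. \<forall>y\<in>fst G. {x, y} \<in> snd G \<longleftrightarrow> {f x, f y} \<in> snd H))"

definition contact_graph :: "(complex \<times> real) set set \<Rightarrow> (complex \<times> real) set graph" where
  "contact_graph V = (V, {{X, Y} |X Y. X \<in> V \<and> Y \<in> V \<and> tangent X Y})"

text \<open>Vertex \<open>\<plusminus>k\<close> stands for the vertex \<open>\<plusminus>e\<^sub>k\<close> of the regular octahedron; exactly antipodal
  vertices are not joined by an edge.\<close>

definition octahedron_graph :: "int graph" where
  "octahedron_graph =
     (let V = {1, 2, 3, - 1, - 2, - 3} in (V, {{i, j} |i j. i \<in> V \<and> j \<in> V \<and> i \<noteq> j \<and> i \<noteq> - j}))"

definition octahedral_completion ::
  "(complex \<times> real) set set \<Rightarrow> (complex \<times> real) set set \<Rightarrow> bool" where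
  "octahedral_completion T U \<longleftrightarrow>
     card U = 3 \<and> (\<forall>X\<in>U. normal_sphere X) \<and> pairwise tangent U \<and> T \<inter> U = {} \<and>
     graph_iso (contact_graph (T \<union> U)) octahedron_graph"

definition octahedral_step ::
  "(complex \<times> real) set set \<Rightarrow> (complex \<times> real) set set \<Rightarrow> bool" where
  "octahedral_step A B \<longleftrightarrow>
     (\<exists>T U. T \<subseteq> A \<and> card T = 3 \<and> pairwise tangent T \<and> octahedral_completion T U \<and> B = A \<union> U)"

definition G_i :: "(complex \<times> real) set set" where
  "G_i = \<Union> {A. octahedral_step\<^sup>*\<^sup>* {Sab 0 1, Sab 1 1, Sab 1 0} A}"


text \<open>The Poincare extension of \<open>z \<mapsto> (a z + b) / (c z + d)\<close>, where \<open>a d - b c \<noteq> 0\<close>: writing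
  \<open>(z, t)\<close> as the quaternion \<open>q = z + t j\<close>, it is \<open>q \<mapsto> (a q + b) (c q + d)\<^sup>-\<^sup>1\<close> for coefficients
  normalized to \<open>a d - b c = 1\<close>. It is used on the open upper half space, where the denominator
  does not vanish.\<close>

definition poincare_ext ::
  "complex \<Rightarrow> complex \<Rightarrow> complex \<Rightarrow> complex \<Rightarrow> complex \<times> real \<Rightarrow> complex \<times> real" where
  "poincare_ext a b c d = (\<lambda>(z, t).
     let D = (norm (c * z + d))\<^sup>2 + (norm c)\<^sup>2 * t\<^sup>2 in
     (((a * z + b) * cnj (c * z + d) + a * cnj c * of_real (t\<^sup>2)) / of_real D,
      norm (a * d - b * c) * t / D))"

text \<open>The coefficients of \<open>M(z) = \<i> z / ((1 - z) \<omega>)\<close>.\<close>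

definition M_ext :: "complex \<times> real \<Rightarrow> complex \<times> real" where
  "M_ext = poincare_ext \<i> 0 (- omega) omega"

lemma M_ext_boundary:
  assumes "z \<noteq> 1"
  shows "M_ext (z, 0) = (\<i> * z / ((1 - z) * omega), 0)"
proof -
  have "omega \<noteq> 0"
    by (auto simp: omega_def complex_eq_iff)
  then have w: "(1 - z) * omega \<noteq> 0"
    using assms by simp
  have eq: "- omega * z + omega = (1 - z) * omega"
    by (simp add: algebra_simps)
  have "\<i> * z * cnj ((1 - z) * omega) / of_real ((norm ((1 - z) * omega))\<^sup>2) =
        \<i> * z / ((1 - z) * omega)"
    using w unfolding complex_norm_square by (metis complex_cnj_zero_iff mult_divide_mult_cancel_right)
  then show ?thesis
    unfolding M_ext_def poincare_ext_def Let_def prod.case eq by simp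
qed

text \<open>The image of a normal sphere under an extension \<open>F\<close>. A sphere's point of contact with \<open>\<complex>\<close> may
  be sent to infinity, or infinity to a point of \<open>\<complex>\<close>; so \<open>F\<close> is applied to the points above \<open>\<complex>\<close>, and
  the closure adds the point of contact of the image when that is finite.\<close>

definition sphere_image ::
  "(complex \<times> real \<Rightarrow> complex \<times> real) \<Rightarrow> (complex \<times> real) set \<Rightarrow> (complex \<times> real) set" where
  "sphere_image F X = closure (F ` {p \<in> X. snd p > 0})"

end

theory Submission
  imports Defs
begin

text \<open>
  Normal spheres correspond to the nonzero null vectors \<open>(p, q, m, c)\<close>, \<open>p q = m\<^sup>2 + c\<^sup>2\<close>, on
  the positive half of the light cone of a Lorentzian form: the sphere touching \<open>\<complex>\<close> at
  \<open>(m + \<i> c) / p\<close> with radius \<open>1 / (2 p)\<close>, or the plane of height \<open>q\<close> if \<open>p = 0\<close>. In this model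
  tangency says that the form takes the value \<open>1\<close> (lemma \<open>tangent_sph\<close>), and Moebius
  transformations act by linear isometries. All three families turn out to be the spheres of the
  primitive integral null vectors, and the proof compares each of them with the orbit of the
  starting plane under the integral isometries that come from \<open>z \<mapsto> \<i> z\<close>, \<open>z \<mapsto> z + \<i>\<close> and
  \<open>z \<mapsto> 1 / z\<close>.

  A Euclidean descent (lemma \<open>orbit_unique\<close>) shows that a set of integral null vectors closed
  under these isometries, in which the starting plane is the only vector with \<open>p = 0\<close>, is this
  orbit. It applies to the primitive vectors, and to the vectors \<open>(\<bar>\<beta>\<bar>\<^sup>2, \<bar>\<alpha>\<bar>\<^sup>2, \<alpha> cnj \<beta>)\<close> of
  coprime pairs, which are those of the spheres \<open>S\<^bsub>\<alpha>,\<beta>\<^esub>\<close>.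

  The spheres of the octahedral procedure form the smallest set that contains the start and is
  closed under completing mutually tangent triples to octahedra. That they are spheres of orbit
  vectors follows since the completion of an integral triple is integral: an isometry moves one
  of its spheres to the plane of height \<open>1\<close>, and then the four neighbours of the plane touch \<open>\<complex>\<close>
  at the vertices of a unit square (lemma \<open>integral_completions_v_inf\<close>). Conversely, the
  generated set is invariant under the three isometries, because by minimality this need only be
  checked on the start, whose images lie in one octahedron.

  Finally, the inverse of \<open>M\<close> acts on the equations of spheres by an explicit linear map, which
  sends \<open>(a + c, b + c, m, c)\<close> to the vector of \<open>\<langle>a + m / \<surd>3, b + m / \<surd>3, c + m / \<surd>3\<rangle>\<close>; under
  this substitution the arithmetic conditions on \<open>a, b, c, m\<close> say that the vector is null,
  positive and primitive.
\<close>

section \<open>Normal spheres as null vectors\<close>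

type_synonym vec = "real \<times> real \<times> real \<times> real"

text \<open>The first two entries are the denominator and the numerator of the squared modulus of the
  point of contact, the last two its numerator: for \<open>\<theta> = m + \<i> c\<close> and \<open>p q = \<bar>\<theta>\<bar>\<^sup>2\<close>, the point
  is \<open>\<theta> / p\<close>. Equivalently, the vector is a Hermitian matrix of rank one with diagonal \<open>q, p\<close>
  and corner \<open>\<theta>\<close>. At \<open>p = 0\<close> only \<open>q\<close> survives, as the height of a plane, which makes tangency
  uniform in the two kinds of normal spheres.\<close>

fun sph :: "vec \<Rightarrow> (complex \<times> real) set" where
  "sph (p, q, m, c) = (if p = 0 then Plane q else Sph (Complex m c / of_real p) (1 / (2 * p)))"

definition lightcone :: "vec set" where
  "lightcone = {(p, q, m, c). 0 \<le> p \<and> 0 \<le> q \<and> p * q = m\<^sup>2 + c\<^sup>2 \<and> 0 < p + q}"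

text \<open>The polarization of \<open>2 (p q - m\<^sup>2 - c\<^sup>2)\<close>, a form of signature \<open>(1, 3)\<close>.\<close>

fun form :: "vec \<Rightarrow> vec \<Rightarrow> real" where
  "form (p, q, m, c) (p', q', m', c') = p * q' + q * p' - 2 * m * m' - 2 * c * c'"

lemma form_self: "v \<in> lightcone \<Longrightarrow> form v v = 0"
  by (cases v) (auto simp: lightcone_def power2_eq_square mult.commute)

text \<open>Membership without a square root: a normal sphere is given by one quadratic equation.\<close>

lemma mem_Sph: "(w, t) \<in> Sph z r \<longleftrightarrow> 0 \<le> r \<and> (norm (w - z))\<^sup>2 + t\<^sup>2 = 2 * r * t"
proof -
  have "dist (z, r) (w, t) = sqrt ((norm (w - z))\<^sup>2 + (t - r)\<^sup>2)"
    by (simp add: dist_Pair_Pair dist_commute[of z] dist_commute[of r])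
      (simp add: dist_norm)
  then have "(w, t) \<in> Sph z r \<longleftrightarrow> sqrt ((norm (w - z))\<^sup>2 + (t - r)\<^sup>2) = r"
    by (simp add: Sph_def)
  also have "\<dots> \<longleftrightarrow> 0 \<le> r \<and> (norm (w - z))\<^sup>2 + (t - r)\<^sup>2 = r\<^sup>2"
    by (metis real_sqrt_ge_zero real_sqrt_pow2 real_sqrt_unique sum_power2_ge_zero)
  also have "\<dots> \<longleftrightarrow> 0 \<le> r \<and> (norm (w - z))\<^sup>2 + t\<^sup>2 = 2 * r * t"
    by (auto simp: power2_eq_square algebra_simps)
  finally show ?thesis .
qed

text \<open>The lowest and the highest point determine a normal sphere.\<close>

lemma Sph_inject:
  assumes "0 < r" "0 < s" "Sph z r = Sph w s"
  shows "z = w \<and> r = s"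
proof -
  have "(z, 0) \<in> Sph w s" "(z, 2 * r) \<in> Sph w s"
    using assms by (auto simp flip: assms(3) simp: mem_Sph power2_eq_square)
  then show ?thesis
    using assms by (auto simp: mem_Sph power2_eq_square)
qed

lemma Sph_neq_Plane:
  assumes "0 < r" "0 < h"
  shows "Sph z r \<noteq> Plane h" "Plane h \<noteq> Sph z r"
proof -
  have "(z, 0) \<in> Sph z r" "(z, 0) \<notin> Plane h"
    using assms by (auto simp: mem_Sph Plane_def)
  then show "Sph z r \<noteq> Plane h" "Plane h \<noteq> Sph z r"
    by auto
qed

lemma Plane_inject: "Plane h = Plane k \<longleftrightarrow> h = k"
  by (auto simp: Plane_def)

lemma lightcone_cases:
  assumes "v \<in> lightcone"
  obtains (plane) h where "0 < h" "v = (0, h, 0, 0)" "sph v = Plane h"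
  | (sphere) p m c where "0 < p" "v = (p, (m\<^sup>2 + c\<^sup>2) / p, m, c)"
      "sph v = Sph (Complex m c / of_real p) (1 / (2 * p))"
proof -
  obtain p q m c where v: "v = (p, q, m, c)" by (cases v)
  show thesis
  proof (cases "p = 0")
    case True
    with assms show thesis
      by (intro plane[of q]) (auto simp: v lightcone_def sum_power2_eq_zero_iff)
  next
    case False
    with assms show thesis
      by (intro sphere[of p m c]) (auto simp: v lightcone_def field_simps)
  qed
qed

lemma sph_inject:
  assumes "v \<in> lightcone" "w \<in> lightcone" "sph v = sph w"
  shows "v = w"
  using assms(1)
proof (cases rule: lightcone_cases)
  case v: (plane h)
  from assms(2) show ?thesis
  proof (cases rule: lightcone_cases)
    case (plane k)
    with v assms(3) show ?thesis by (simp add: Plane_inject)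
  next
    case (sphere p m c)
    with v assms(3) show ?thesis
      by (metis Sph_neq_Plane(2) divide_pos_pos mult_pos_pos zero_less_one zero_less_numeral)
  qed
next
  case v: (sphere p m c)
  from assms(2) show ?thesis
  proof (cases rule: lightcone_cases)
    case (plane k)
    with v assms(3) show ?thesis
      by (metis Sph_neq_Plane(1) divide_pos_pos mult_pos_pos zero_less_one zero_less_numeral)
  next
    case w: (sphere p' m' c')
    have "Complex m c / of_real p = Complex m' c' / of_real p' \<and> 1 / (2 * p) = 1 / (2 * p')"
      using v w assms(3) by (intro Sph_inject) auto
    with v w show ?thesis by (auto simp: complex_eq_iff)
  qed
qed

lemma normal_sphere_iff: "normal_sphere X \<longleftrightarrow> X \<in> sph ` lightcone"
proof
  assume "normal_sphere X"
  then consider z r where "r > 0" "X = Sph z r" | h where "h > 0" "X = Plane h"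
    by (auto simp: normal_sphere_def)
  then show "X \<in> sph ` lightcone"
  proof cases
    case (1 z r)
    let ?p = "1 / (2 * r)"
    have "X = sph (?p, (norm z)\<^sup>2 * ?p, Re z * ?p, Im z * ?p)"
      using 1 by (auto simp: complex_eq_iff intro!: arg_cong2[where f = Sph])
    moreover have "(?p, (norm z)\<^sup>2 * ?p, Re z * ?p, Im z * ?p) \<in> lightcone"
      using 1 cmod_power2[of z]
      by (auto simp: lightcone_def field_simps power2_eq_square add_pos_nonneg)
    ultimately show ?thesis by blast
  next
    case (2 h)
    then have "X = sph (0, h, 0, 0)" "(0, h, 0, 0) \<in> lightcone"
      by (auto simp: lightcone_def)
    then show ?thesis by blast
  qed
next
  assume "X \<in> sph ` lightcone"
  then obtain v where v: "v \<in> lightcone" "X = sph v" by blast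
  from v(1) show "normal_sphere X"
  proof (cases rule: lightcone_cases)
    case (plane h)
    with v show ?thesis by (auto simp: normal_sphere_def)
  next
    case (sphere p m c)
    with v have "X = Sph (Complex m c / of_real p) (1 / (2 * p))" "1 / (2 * p) > 0"
      by auto
    then show ?thesis unfolding normal_sphere_def by blast
  qed
qed

lemma tangent_Sph_Sph:
  assumes "0 < r" "0 < s"
  shows "tangent (Sph z r) (Sph w s) \<longleftrightarrow> (norm (z - w))\<^sup>2 = 4 * r * s"
proof
  assume "tangent (Sph z r) (Sph w s)"
  with assms show "(norm (z - w))\<^sup>2 = 4 * r * s"
    unfolding tangent_def by (metis Sph_inject Sph_neq_Plane)
next
  assume h: "(norm (z - w))\<^sup>2 = 4 * r * s"
  with assms have "z \<noteq> w" by auto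
  with assms h show "tangent (Sph z r) (Sph w s)"
    unfolding tangent_def by blast
qed

lemma tangent_Plane_Sph:
  assumes "0 < h" "0 < r"
  shows "tangent (Plane h) (Sph z r) \<longleftrightarrow> h = 2 * r" "tangent (Sph z r) (Plane h) \<longleftrightarrow> h = 2 * r"
proof -
  show "tangent (Plane h) (Sph z r) \<longleftrightarrow> h = 2 * r"
  proof
    assume "tangent (Plane h) (Sph z r)"
    with assms show "h = 2 * r"
      unfolding tangent_def by (metis Sph_inject Sph_neq_Plane Plane_inject)
  qed (use assms in \<open>unfold tangent_def, blast\<close>)
  show "tangent (Sph z r) (Plane h) \<longleftrightarrow> h = 2 * r"
  proof
    assume "tangent (Sph z r) (Plane h)"
    with assms show "h = 2 * r"
      unfolding tangent_def by (metis Sph_inject Sph_neq_Plane Plane_inject)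
  qed (use assms in \<open>unfold tangent_def, blast\<close>)
qed

lemma not_tangent_Plane_Plane:
  assumes "0 < h" "0 < k"
  shows "\<not> tangent (Plane h) (Plane k)"
  using assms unfolding tangent_def by (metis Sph_neq_Plane)

text \<open>For two spheres, \<open>\<bar>z - w\<bar>\<^sup>2 = 4 r s\<close> with \<open>z = \<theta> / p\<close> and \<open>r = 1 / (2 p)\<close>, multiplied by
  \<open>p p'\<close>, is \<open>form v w = 1\<close>. Two spheres with the same point of contact, and two planes, give
  proportional null vectors, hence the value \<open>0\<close>, in agreement with their not being tangent.\<close>

lemma tangent_sph:
  assumes "v \<in> lightcone" "w \<in> lightcone"
  shows "tangent (sph v) (sph w) \<longleftrightarrow> form v w = 1"
  using assms(1)
proof (cases rule: lightcone_cases)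
  case v: (plane h)
  from assms(2) show ?thesis
  proof (cases rule: lightcone_cases)
    case (plane k)
    with v show ?thesis by (simp add: not_tangent_Plane_Plane)
  next
    case (sphere p m c)
    have "form v w = h * p" using v sphere by simp
    moreover have "tangent (sph v) (sph w) \<longleftrightarrow> h = 2 * (1 / (2 * p))"
      unfolding v(3) sphere(3) by (rule tangent_Plane_Sph) (use v sphere in auto)
    ultimately show ?thesis using sphere(1) by (auto simp: field_simps)
  qed
next
  case v: (sphere p m c)
  from assms(2) show ?thesis
  proof (cases rule: lightcone_cases)
    case (plane h)
    have "form v w = h * p" using v plane by simp
    moreover have "tangent (sph v) (sph w) \<longleftrightarrow> h = 2 * (1 / (2 * p))"
      unfolding v(3) plane(3) by (rule tangent_Plane_Sph) (use v plane in auto)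
    ultimately show ?thesis using v(1) by (auto simp: field_simps)
  next
    case w: (sphere p' m' c')
    have "tangent (sph v) (sph w) \<longleftrightarrow>
        (norm (Complex m c / of_real p - Complex m' c' / of_real p'))\<^sup>2
          = 4 * (1 / (2 * p)) * (1 / (2 * p'))"
      unfolding v(3) w(3) by (rule tangent_Sph_Sph) (use v w in auto)
    also have "\<dots> \<longleftrightarrow> (m / p - m' / p')\<^sup>2 + (c / p - c' / p')\<^sup>2 = 1 / (p * p')"
      by (simp add: cmod_power2)
    also have "(m / p - m' / p')\<^sup>2 + (c / p - c' / p')\<^sup>2 = form v w / (p * p')"
      using v(1) w(1) by (simp add: v(2) w(2) field_simps power2_eq_square)
    also have "\<dots> = 1 / (p * p') \<longleftrightarrow> form v w = 1"
      using v(1) w(1) by auto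
    finally show ?thesis .
  qed
qed

section \<open>Octahedra of null vectors\<close>

text \<open>The six spheres of an octahedral contact graph, with \<open>v\<^sub>k\<close> opposite to \<open>u\<^sub>k\<close>. Opposite
  vectors are required to be distinct because the form takes the value \<open>0\<close>, and not \<open>1\<close>, on
  equal ones.\<close>

definition octahedron :: "vec \<Rightarrow> vec \<Rightarrow> vec \<Rightarrow> vec \<Rightarrow> vec \<Rightarrow> vec \<Rightarrow> bool" where
  "octahedron v\<^sub>1 v\<^sub>2 v\<^sub>3 u\<^sub>1 u\<^sub>2 u\<^sub>3 \<longleftrightarrow>
     {v\<^sub>1, v\<^sub>2, v\<^sub>3, u\<^sub>1, u\<^sub>2, u\<^sub>3} \<subseteq> lightcone \<and>
     form v\<^sub>1 v\<^sub>2 = 1 \<and> form v\<^sub>1 v\<^sub>3 = 1 \<and> form v\<^sub>2 v\<^sub>3 = 1 \<and>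
     form u\<^sub>1 u\<^sub>2 = 1 \<and> form u\<^sub>1 u\<^sub>3 = 1 \<and> form u\<^sub>2 u\<^sub>3 = 1 \<and>
     form v\<^sub>1 u\<^sub>2 = 1 \<and> form v\<^sub>1 u\<^sub>3 = 1 \<and> form v\<^sub>2 u\<^sub>1 = 1 \<and>
     form v\<^sub>2 u\<^sub>3 = 1 \<and> form v\<^sub>3 u\<^sub>1 = 1 \<and> form v\<^sub>3 u\<^sub>2 = 1 \<and>
     form v\<^sub>1 u\<^sub>1 \<noteq> 1 \<and> form v\<^sub>2 u\<^sub>2 \<noteq> 1 \<and> form v\<^sub>3 u\<^sub>3 \<noteq> 1 \<and>
     v\<^sub>1 \<noteq> u\<^sub>1 \<and> v\<^sub>2 \<noteq> u\<^sub>2 \<and> v\<^sub>3 \<noteq> u\<^sub>3"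

lemma tangent_commute: "tangent X Y \<longleftrightarrow> tangent Y X"
proof -
  have "tangent Y X" if "tangent X Y" for X Y
    using that[unfolded tangent_def]
  proof (elim disjE exE conjE)
    fix z w r s
    assume "r > 0" "s > 0" "z \<noteq> w" "X = Sph z r" "Y = Sph w s" "(norm (z - w))\<^sup>2 = 4 * r * s"
    then show "tangent Y X"
      unfolding tangent_def
      by (intro disjI1 exI[of _ w] exI[of _ z] exI[of _ s] exI[of _ r]) (simp add: norm_minus_commute)
  qed (simp_all add: tangent_def, blast+)
  then show ?thesis by blast
qed

lemma contact_graph_edge:
  assumes "X \<in> V" "Y \<in> V"
  shows "{X, Y} \<in> snd (contact_graph V) \<longleftrightarrow> tangent X Y"
  using assms unfolding contact_graph_def by (auto simp: doubleton_eq_iff tangent_commute)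

lemma octahedron_graph_edge:
  assumes "i \<in> fst octahedron_graph" "j \<in> fst octahedron_graph"
  shows "{i, j} \<in> snd octahedron_graph \<longleftrightarrow> i \<noteq> j \<and> i \<noteq> - j"
proof -
  define V :: "int set" where "V = {1, 2, 3, - 1, - 2, - 3}"
  have G: "octahedron_graph = (V, {{i, j} |i j. i \<in> V \<and> j \<in> V \<and> i \<noteq> j \<and> i \<noteq> - j})"
    unfolding octahedron_graph_def V_def Let_def ..
  show ?thesis
    using assms unfolding G fst_conv snd_conv by (auto simp: doubleton_eq_iff)
qed

lemma fst_octahedron_graph: "fst octahedron_graph = {1, 2, 3, - 1, - 2, - 3}"
  by (simp add: octahedron_graph_def Let_def)

lemma fst_contact_graph: "fst (contact_graph V) = V"
  by (simp add: contact_graph_def)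

text \<open>The labelling of the vertices that identifies the contact graph with the octahedron can be
  read off, \<open>v\<^sub>k\<close> becoming \<open>k\<close> and \<open>u\<^sub>k\<close> becoming \<open>- k\<close>.\<close>

lemma octahedral_completion_if_octahedron:
  assumes "octahedron v\<^sub>1 v\<^sub>2 v\<^sub>3 u\<^sub>1 u\<^sub>2 u\<^sub>3"
  shows "octahedral_completion {sph v\<^sub>1, sph v\<^sub>2, sph v\<^sub>3} {sph u\<^sub>1, sph u\<^sub>2, sph u\<^sub>3}"
    and "card {sph v\<^sub>1, sph v\<^sub>2, sph v\<^sub>3} = 3" "pairwise tangent {sph v\<^sub>1, sph v\<^sub>2, sph v\<^sub>3}"
proof -
  let ?T = "{sph v\<^sub>1, sph v\<^sub>2, sph v\<^sub>3}"
    and ?U = "{sph u\<^sub>1, sph u\<^sub>2, sph u\<^sub>3}"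
  have lightcone: "v\<^sub>1 \<in> lightcone" "v\<^sub>2 \<in> lightcone" "v\<^sub>3 \<in> lightcone"
    "u\<^sub>1 \<in> lightcone" "u\<^sub>2 \<in> lightcone" "u\<^sub>3 \<in> lightcone"
    using assms by (auto simp: octahedron_def)
  note tan = tangent_sph[OF lightcone(1)] tangent_sph[OF lightcone(2)] tangent_sph[OF lightcone(3)]
    tangent_sph[OF lightcone(4)] tangent_sph[OF lightcone(5)] tangent_sph[OF lightcone(6)]
  have t: "tangent (sph v\<^sub>1) (sph v\<^sub>2)" "tangent (sph v\<^sub>1) (sph v\<^sub>3)" "tangent (sph v\<^sub>2) (sph v\<^sub>3)"
    "tangent (sph u\<^sub>1) (sph u\<^sub>2)" "tangent (sph u\<^sub>1) (sph u\<^sub>3)" "tangent (sph u\<^sub>2) (sph u\<^sub>3)"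
    "tangent (sph v\<^sub>1) (sph u\<^sub>2)" "tangent (sph v\<^sub>1) (sph u\<^sub>3)" "tangent (sph v\<^sub>2) (sph u\<^sub>1)"
    "tangent (sph v\<^sub>2) (sph u\<^sub>3)" "tangent (sph v\<^sub>3) (sph u\<^sub>1)" "tangent (sph v\<^sub>3) (sph u\<^sub>2)"
    "\<not> tangent (sph v\<^sub>1) (sph u\<^sub>1)" "\<not> tangent (sph v\<^sub>2) (sph u\<^sub>2)" "\<not> tangent (sph v\<^sub>3) (sph u\<^sub>3)"
    using assms lightcone by (auto simp: octahedron_def tan)
  have t': "tangent (sph v\<^sub>2) (sph v\<^sub>1)" "tangent (sph v\<^sub>3) (sph v\<^sub>1)" "tangent (sph v\<^sub>3) (sph v\<^sub>2)"
    "tangent (sph u\<^sub>2) (sph u\<^sub>1)" "tangent (sph u\<^sub>3) (sph u\<^sub>1)" "tangent (sph u\<^sub>3) (sph u\<^sub>2)"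
    "tangent (sph u\<^sub>2) (sph v\<^sub>1)" "tangent (sph u\<^sub>3) (sph v\<^sub>1)" "tangent (sph u\<^sub>1) (sph v\<^sub>2)"
    "tangent (sph u\<^sub>3) (sph v\<^sub>2)" "tangent (sph u\<^sub>1) (sph v\<^sub>3)" "tangent (sph u\<^sub>2) (sph v\<^sub>3)"
    "\<not> tangent (sph u\<^sub>1) (sph v\<^sub>1)" "\<not> tangent (sph u\<^sub>2) (sph v\<^sub>2)" "\<not> tangent (sph u\<^sub>3) (sph v\<^sub>3)"
    using t tangent_commute by blast+
  have irrefl: "\<not> tangent (sph v) (sph v)" if "v \<in> lightcone" for v
    using that by (simp add: tangent_sph form_self)
  note i = lightcone[THEN irrefl]
  have opp: "sph v\<^sub>1 \<noteq> sph u\<^sub>1" "sph v\<^sub>2 \<noteq> sph u\<^sub>2" "sph v\<^sub>3 \<noteq> sph u\<^sub>3"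
    using assms lightcone by (auto simp: octahedron_def dest: sph_inject)
  have adj: "sph v\<^sub>1 \<noteq> sph v\<^sub>2" "sph v\<^sub>1 \<noteq> sph v\<^sub>3" "sph v\<^sub>2 \<noteq> sph v\<^sub>3"
    "sph u\<^sub>1 \<noteq> sph u\<^sub>2" "sph u\<^sub>1 \<noteq> sph u\<^sub>3" "sph u\<^sub>2 \<noteq> sph u\<^sub>3"
    "sph v\<^sub>1 \<noteq> sph u\<^sub>2" "sph v\<^sub>1 \<noteq> sph u\<^sub>3" "sph v\<^sub>2 \<noteq> sph u\<^sub>1"
    "sph v\<^sub>2 \<noteq> sph u\<^sub>3" "sph v\<^sub>3 \<noteq> sph u\<^sub>1" "sph v\<^sub>3 \<noteq> sph u\<^sub>2"
    using t(1-12) i by auto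
  note d = opp adj opp[symmetric] adj[symmetric]
  define f :: "(complex \<times> real) set \<Rightarrow> int" where
    "f X = (if X = sph v\<^sub>1 then 1 else if X = sph v\<^sub>2 then 2 else if X = sph v\<^sub>3 then 3
       else if X = sph u\<^sub>1 then - 1 else if X = sph u\<^sub>2 then - 2 else - 3)" for X
  have f: "f (sph v\<^sub>1) = 1" "f (sph v\<^sub>2) = 2" "f (sph v\<^sub>3) = 3"
    "f (sph u\<^sub>1) = - 1" "f (sph u\<^sub>2) = - 2" "f (sph u\<^sub>3) = - 3"
    using d by (simp_all add: f_def)
  have "bij_betw f (?T \<union> ?U) (fst octahedron_graph)"
    by (intro bij_betw_imageI inj_onI) (auto simp: f fst_octahedron_graph)
  moreover have "{X, Y} \<in> snd (contact_graph (?T \<union> ?U)) \<longleftrightarrow> {f X, f Y} \<in> snd octahedron_graph"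
    if XY: "X \<in> ?T \<union> ?U" "Y \<in> ?T \<union> ?U" for X Y
  proof -
    have "tangent X Y \<longleftrightarrow> f X \<noteq> f Y \<and> f X \<noteq> - f Y"
      using XY by (auto simp: f t t' i)
    moreover have "f X \<in> fst octahedron_graph" "f Y \<in> fst octahedron_graph"
      using XY by (auto simp: f fst_octahedron_graph)
    ultimately show ?thesis
      using XY by (simp only: contact_graph_edge octahedron_graph_edge)
  qed
  ultimately have "graph_iso (contact_graph (?T \<union> ?U)) octahedron_graph"
    unfolding graph_iso_def fst_contact_graph by blast
  moreover have "pairwise tangent ?U" "\<forall>X\<in>?U. normal_sphere X"
    using t t' lightcone by (auto simp: pairwise_def normal_sphere_iff)
  moreover have "card ?U = 3" "?T \<inter> ?U = {}"
    using d by auto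
  ultimately show "octahedral_completion ?T ?U"
    unfolding octahedral_completion_def by blast
  show "card ?T = 3" "pairwise tangent ?T"
    using d t t' by (auto simp: pairwise_def)
qed

text \<open>In the octahedron graph each vertex has exactly one antipode. The antipode of a member of
  \<open>T\<close> is not tangent to it, so it cannot lie in the mutually tangent set \<open>T\<close> and must be a
  member of \<open>U\<close>; this pairs the three spheres of \<open>T\<close> with the three of \<open>U\<close>.\<close>

lemma octahedron_if_octahedral_completion:
  assumes TU: "octahedral_completion T U" and T: "T \<subseteq> sph ` C" "C \<subseteq> lightcone" "card T = 3"
    "pairwise tangent T"
  obtains v\<^sub>1 v\<^sub>2 v\<^sub>3 u\<^sub>1 u\<^sub>2 u\<^sub>3 where "octahedron v\<^sub>1 v\<^sub>2 v\<^sub>3 u\<^sub>1 u\<^sub>2 u\<^sub>3"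
    "{v\<^sub>1, v\<^sub>2, v\<^sub>3} \<subseteq> C" "U = {sph u\<^sub>1, sph u\<^sub>2, sph u\<^sub>3}"
proof -
  let ?G = "contact_graph (T \<union> U)"
  obtain f where f: "bij_betw f (T \<union> U) (fst octahedron_graph)"
    and edge: "\<And>X Y. X \<in> T \<union> U \<Longrightarrow> Y \<in> T \<union> U \<Longrightarrow>
      {X, Y} \<in> snd ?G \<longleftrightarrow> {f X, f Y} \<in> snd octahedron_graph"
    using TU unfolding octahedral_completion_def graph_iso_def fst_contact_graph by blast
  have f_in: "f X \<in> fst octahedron_graph" if "X \<in> T \<union> U" for X
    using f that by (meson bij_betwE)
  have f_inj: "f X = f Y \<longleftrightarrow> X = Y" if "X \<in> T \<union> U" "Y \<in> T \<union> U" for X Y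
    using f that by (meson bij_betw_def inj_on_eq_iff)
  have tan: "tangent X Y \<longleftrightarrow> f X \<noteq> f Y \<and> f X \<noteq> - f Y" if "X \<in> T \<union> U" "Y \<in> T \<union> U" for X Y
    using edge[OF that] that by (simp only: contact_graph_edge octahedron_graph_edge f_in)
  have disj: "T \<inter> U = {}" and U: "card U = 3" "\<And>X. X \<in> U \<Longrightarrow> normal_sphere X"
    "pairwise tangent U"
    using TU by (auto simp: octahedral_completion_def)
  have antipode: "\<exists>Y\<in>U. f Y = - f X" if X: "X \<in> T" for X
  proof -
    have "- f X \<in> fst octahedron_graph"
      using f_in[of X] X by (auto simp: fst_octahedron_graph)
    then obtain Y where Y: "Y \<in> T \<union> U" "f Y = - f X"
      using f by (metis bij_betw_iff_bijections)
    have "f X \<noteq> 0" using f_in[of X] X by (auto simp: fst_octahedron_graph)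
    with Y have "X \<noteq> Y" by auto
    moreover have "\<not> tangent X Y" using tan[of X Y] X Y by auto
    ultimately have "Y \<notin> T" using T(4) X by (auto simp: pairwise_def)
    with Y show ?thesis by blast
  qed
  obtain X\<^sub>1 X\<^sub>2 X\<^sub>3 where X: "T = {X\<^sub>1, X\<^sub>2, X\<^sub>3}" "X\<^sub>1 \<noteq> X\<^sub>2" "X\<^sub>1 \<noteq> X\<^sub>3" "X\<^sub>2 \<noteq> X\<^sub>3"
    using T(3) by (auto simp: card_3_iff)
  obtain Y\<^sub>1 Y\<^sub>2 Y\<^sub>3 where Y: "Y\<^sub>1 \<in> U" "f Y\<^sub>1 = - f X\<^sub>1" "Y\<^sub>2 \<in> U" "f Y\<^sub>2 = - f X\<^sub>2"
    "Y\<^sub>3 \<in> U" "f Y\<^sub>3 = - f X\<^sub>3"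
    using antipode X(1) by (meson insertI1 insertI2)
  have ne: "Y\<^sub>1 \<noteq> Y\<^sub>2" "Y\<^sub>1 \<noteq> Y\<^sub>3" "Y\<^sub>2 \<noteq> Y\<^sub>3"
    using X Y f_inj[of X\<^sub>1 X\<^sub>2] f_inj[of X\<^sub>1 X\<^sub>3] f_inj[of X\<^sub>2 X\<^sub>3] by auto
  have UY: "U = {Y\<^sub>1, Y\<^sub>2, Y\<^sub>3}"
  proof (rule sym, rule card_subset_eq)
    show "finite U" using U(1) by (metis card.infinite zero_neq_numeral)
  qed (use Y ne U(1) in auto)
  obtain v\<^sub>1 v\<^sub>2 v\<^sub>3 where v: "X\<^sub>1 = sph v\<^sub>1" "X\<^sub>2 = sph v\<^sub>2" "X\<^sub>3 = sph v\<^sub>3"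
    "v\<^sub>1 \<in> C" "v\<^sub>2 \<in> C" "v\<^sub>3 \<in> C"
    using T(1) unfolding X(1) by (auto simp: image_iff)
  then have vc: "v\<^sub>1 \<in> lightcone" "v\<^sub>2 \<in> lightcone" "v\<^sub>3 \<in> lightcone"
    using T(2) by auto
  have "U \<subseteq> sph ` lightcone" using U(2) by (auto simp: normal_sphere_iff)
  then obtain u\<^sub>1 u\<^sub>2 u\<^sub>3 where u: "Y\<^sub>1 = sph u\<^sub>1" "Y\<^sub>2 = sph u\<^sub>2" "Y\<^sub>3 = sph u\<^sub>3"
    "u\<^sub>1 \<in> lightcone" "u\<^sub>2 \<in> lightcone" "u\<^sub>3 \<in> lightcone"
    unfolding UY by (auto simp: image_iff)
  have TT: "tangent X\<^sub>1 X\<^sub>2" "tangent X\<^sub>1 X\<^sub>3" "tangent X\<^sub>2 X\<^sub>3"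
    using T(4) X by (auto simp: pairwise_def)
  have UU: "tangent Y\<^sub>1 Y\<^sub>2" "tangent Y\<^sub>1 Y\<^sub>3" "tangent Y\<^sub>2 Y\<^sub>3"
    using U(3) UY ne by (auto simp: pairwise_def)
  have mem: "X\<^sub>1 \<in> T \<union> U" "X\<^sub>2 \<in> T \<union> U" "X\<^sub>3 \<in> T \<union> U" "Y\<^sub>1 \<in> T \<union> U" "Y\<^sub>2 \<in> T \<union> U" "Y\<^sub>3 \<in> T \<union> U"
    using X UY by auto
  note fne = TT[unfolded tan[OF mem(1,2)] tan[OF mem(1,3)] tan[OF mem(2,3)]]
  have TU': "tangent X\<^sub>1 Y\<^sub>2" "tangent X\<^sub>1 Y\<^sub>3" "tangent X\<^sub>2 Y\<^sub>1" "tangent X\<^sub>2 Y\<^sub>3"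
    "tangent X\<^sub>3 Y\<^sub>1" "tangent X\<^sub>3 Y\<^sub>2"
    "\<not> tangent X\<^sub>1 Y\<^sub>1" "\<not> tangent X\<^sub>2 Y\<^sub>2" "\<not> tangent X\<^sub>3 Y\<^sub>3"
    using fne mem by (auto simp: tan Y)
  have "X\<^sub>1 \<noteq> Y\<^sub>1" "X\<^sub>2 \<noteq> Y\<^sub>2" "X\<^sub>3 \<noteq> Y\<^sub>3"
    using disj X UY by auto
  then have "octahedron v\<^sub>1 v\<^sub>2 v\<^sub>3 u\<^sub>1 u\<^sub>2 u\<^sub>3"
    using TT UU TU' vc u unfolding octahedron_def v(1-3) u(1-3) by (auto simp: tangent_sph)
  then show thesis
    using that v u UY by simp
qed

section \<open>The octahedral procedure as a closure\<close>

abbreviation v_inf :: vec where "v_inf \<equiv> (0, 1, 0, 0)"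
abbreviation v_zero :: vec where "v_zero \<equiv> (1, 0, 0, 0)"
abbreviation v_one :: vec where "v_one \<equiv> (1, 1, 1, 0)"

abbreviation start :: "(complex \<times> real) set set" where
  "start \<equiv> {Sab 0 1, Sab 1 1, Sab 1 0}"

lemma start_eq: "start = {sph v_zero, sph v_one, sph v_inf}"
  using zero_complex.code one_complex.code by (simp add: Sab_def)

text \<open>A step stays possible in a larger collection, so two chains can be run one after the
  other. Hence spheres that occur in different chains also occur together in one.\<close>

lemma octahedral_step_Un:
  assumes "octahedral_step\<^sup>*\<^sup>* start A" "octahedral_step\<^sup>*\<^sup>* start B"
  shows "octahedral_step\<^sup>*\<^sup>* start (A \<union> B)"
  using assms(2)
proof (induction rule: rtranclp_induct)
  case base
  have "start \<subseteq> A"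
    using assms(1) by (induction rule: rtranclp_induct) (auto simp: octahedral_step_def)
  then show ?case using assms(1) by (simp only: Un_absorb2)
next
  case (step B B')
  then obtain T U where "T \<subseteq> B" "card T = 3" "pairwise tangent T"
      "octahedral_completion T U" "B' = B \<union> U"
    by (auto simp: octahedral_step_def)
  then have "octahedral_step (A \<union> B) (A \<union> B')"
    unfolding octahedral_step_def by (intro exI[of _ T] exI[of _ U]) auto
  with step.IH show ?case by (rule rtranclp.rtrancl_into_rtrancl)
qed

text \<open>Together with minimality, this describes the generated set as a closure: a mutually
  tangent triple inside it may be completed in either way.\<close>

lemma G_i_octahedron:
  assumes "octahedron v\<^sub>1 v\<^sub>2 v\<^sub>3 u\<^sub>1 u\<^sub>2 u\<^sub>3" "{sph v\<^sub>1, sph v\<^sub>2, sph v\<^sub>3} \<subseteq> G_i"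
  shows "{sph u\<^sub>1, sph u\<^sub>2, sph u\<^sub>3} \<subseteq> G_i"
proof -
  obtain A\<^sub>1 A\<^sub>2 A\<^sub>3 where A: "octahedral_step\<^sup>*\<^sup>* start A\<^sub>1" "sph v\<^sub>1 \<in> A\<^sub>1"
    "octahedral_step\<^sup>*\<^sup>* start A\<^sub>2" "sph v\<^sub>2 \<in> A\<^sub>2" "octahedral_step\<^sup>*\<^sup>* start A\<^sub>3" "sph v\<^sub>3 \<in> A\<^sub>3"
    using assms(2) by (auto simp: G_i_def)
  let ?A = "A\<^sub>1 \<union> (A\<^sub>2 \<union> A\<^sub>3)" and ?T = "{sph v\<^sub>1, sph v\<^sub>2, sph v\<^sub>3}"
    and ?U = "{sph u\<^sub>1, sph u\<^sub>2, sph u\<^sub>3}"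
  have "octahedral_step ?A (?A \<union> ?U)"
    unfolding octahedral_step_def
  proof (intro exI conjI)
    show "?T \<subseteq> ?A" using A(2,4,6) by simp
  qed (use octahedral_completion_if_octahedron[OF assms(1)] in \<open>simp_all only:\<close>)
  moreover have "octahedral_step\<^sup>*\<^sup>* start ?A"
    using A by (intro octahedral_step_Un)
  ultimately have "octahedral_step\<^sup>*\<^sup>* start (?A \<union> ?U)"
    by (rule rtranclp.rtrancl_into_rtrancl[rotated])
  then show ?thesis unfolding G_i_def by blast
qed

lemma G_i_minimal:
  assumes C: "C \<subseteq> lightcone" "{v_zero, v_one, v_inf} \<subseteq> C"
    and closed: "\<And>v\<^sub>1 v\<^sub>2 v\<^sub>3 u\<^sub>1 u\<^sub>2 u\<^sub>3.
      octahedron v\<^sub>1 v\<^sub>2 v\<^sub>3 u\<^sub>1 u\<^sub>2 u\<^sub>3 \<Longrightarrow> {v\<^sub>1, v\<^sub>2, v\<^sub>3} \<subseteq> C \<Longrightarrow> {u\<^sub>1, u\<^sub>2, u\<^sub>3} \<subseteq> C"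
  shows "G_i \<subseteq> sph ` C"
proof -
  have "A \<subseteq> sph ` C" if "octahedral_step\<^sup>*\<^sup>* start A" for A
    using that
  proof (induction rule: rtranclp_induct)
    case base
    show ?case unfolding start_eq using C(2) by blast
  next
    case (step A B)
    then obtain T U where T: "T \<subseteq> A" "card T = 3" "pairwise tangent T"
      and U: "octahedral_completion T U" and B: "B = A \<union> U"
      by (auto simp: octahedral_step_def)
    obtain v\<^sub>1 v\<^sub>2 v\<^sub>3 u\<^sub>1 u\<^sub>2 u\<^sub>3 where "octahedron v\<^sub>1 v\<^sub>2 v\<^sub>3 u\<^sub>1 u\<^sub>2 u\<^sub>3"
      "{v\<^sub>1, v\<^sub>2, v\<^sub>3} \<subseteq> C" "U = {sph u\<^sub>1, sph u\<^sub>2, sph u\<^sub>3}"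
      using octahedron_if_octahedral_completion[OF U _ C(1) T(2,3)] T(1) step.IH by blast
    with closed show ?case using B step.IH by blast
  qed
  then show ?thesis unfolding G_i_def by blast
qed

section \<open>Integral symmetries and descent\<close>

text \<open>The actions on null vectors of \<open>z \<mapsto> \<i> z\<close>, \<open>z \<mapsto> z + \<i>\<close> and \<open>z \<mapsto> 1 / z\<close>, which generate the
  group \<open>PGL\<^sub>2\<close> of the Gaussian integers.\<close>

fun rot :: "vec \<Rightarrow> vec" where "rot (p, q, m, c) = (p, q, - c, m)"
fun shift :: "vec \<Rightarrow> vec" where "shift (p, q, m, c) = (p, q + 2 * c + p, m, c + p)"
fun swap :: "vec \<Rightarrow> vec" where "swap (p, q, m, c) = (q, p, m, - c)"

definition int_vecs :: "vec set" where
  "int_vecs = \<int> \<times> \<int> \<times> \<int> \<times> \<int>"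

definition lattice_isometry :: "(vec \<Rightarrow> vec) \<Rightarrow> bool" where
  "lattice_isometry g \<longleftrightarrow>
     (\<forall>v w. form (g v) (g w) = form v w) \<and> inj g \<and> g ` lightcone \<subseteq> lightcone \<and> g ` int_vecs \<subseteq> int_vecs"

lemma lattice_isometryI:
  assumes "\<And>v w. form (g v) (g w) = form v w" "inj g"
    and "\<And>v. v \<in> lightcone \<Longrightarrow> g v \<in> lightcone" "\<And>v. v \<in> int_vecs \<Longrightarrow> g v \<in> int_vecs"
  shows "lattice_isometry g"
  using assms unfolding lattice_isometry_def image_subset_iff by (intro conjI allI ballI)

lemma lattice_isometryD:
  assumes "lattice_isometry g"
  shows "form (g v) (g w) = form v w" "g v = g w \<longleftrightarrow> v = w"
    and "v \<in> lightcone \<Longrightarrow> g v \<in> lightcone" "v \<in> int_vecs \<Longrightarrow> g v \<in> int_vecs"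
  using assms[unfolded lattice_isometry_def] by (blast dest: injD)+

lemma lattice_isometry_comp:
  assumes g: "lattice_isometry g" and h: "lattice_isometry h"
  shows "lattice_isometry (\<lambda>v. g (h v))"
  by (rule lattice_isometryI)
    (simp_all only: lattice_isometryD[OF g] lattice_isometryD[OF h] inj_def simp_thms)

lemma rot_rot_rot_rot: "rot (rot (rot (rot v))) = v"
  by (cases v) simp

lemma swap_swap: "swap (swap v) = v"
  by (cases v) simp

lemma shift_inverse: "shift (rot (rot (shift (rot (rot v))))) = v"
  "rot (rot (shift (rot (rot (shift v))))) = v"
  by (cases v, simp)+

lemma lattice_isometry_rot: "lattice_isometry rot"
  by (rule lattice_isometryI) (auto simp: inj_def lightcone_def int_vecs_def)

lemma lattice_isometry_swap: "lattice_isometry swap"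
  by (rule lattice_isometryI) (auto simp: inj_def lightcone_def int_vecs_def mult.commute)

lemma lattice_isometry_shift: "lattice_isometry shift"
proof -
  have "shift v \<in> lightcone" if v: "v \<in> lightcone" for v
  proof -
    obtain p q m c where [simp]: "v = (p, q, m, c)" by (cases v)
    have h: "0 \<le> p" "0 \<le> q" "p * q = m\<^sup>2 + c\<^sup>2" "0 < p + q"
      using v by (auto simp: lightcone_def)
    have eq: "p * (q + 2 * c + p) = m\<^sup>2 + (c + p)\<^sup>2"
      using h(3) by (simp add: power2_eq_square algebra_simps)
    show ?thesis
    proof (cases "p = 0")
      case True
      then show ?thesis using h by (auto simp: lightcone_def sum_power2_eq_zero_iff)
    next
      case False
      then have "0 \<le> q + 2 * c + p"
        using eq h(1) by (metis add_nonneg_nonneg zero_le_power2 order_le_less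
             zero_le_mult_iff linorder_not_le)
      then show ?thesis using False h eq by (auto simp: lightcone_def)
    qed
  qed
  moreover have "inj shift"
    by (rule inj_on_inverseI[where g = "\<lambda>v. rot (rot (shift (rot (rot v))))"]) (rule shift_inverse)
  ultimately show ?thesis
    by (intro lattice_isometryI) (auto simp: int_vecs_def algebra_simps)
qed

lemma octahedron_isometry:
  assumes "lattice_isometry g" "octahedron v\<^sub>1 v\<^sub>2 v\<^sub>3 u\<^sub>1 u\<^sub>2 u\<^sub>3"
  shows "octahedron (g v\<^sub>1) (g v\<^sub>2) (g v\<^sub>3) (g u\<^sub>1) (g u\<^sub>2) (g u\<^sub>3)"
  using assms unfolding octahedron_def by (simp add: lattice_isometryD)

text \<open>It is enough to close under the three maps themselves, since each inverse is a word in
  them.\<close>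

inductive_set orbit :: "vec set" where
  v_inf: "v_inf \<in> orbit"
| rot: "v \<in> orbit \<Longrightarrow> rot v \<in> orbit"
| shift: "v \<in> orbit \<Longrightarrow> shift v \<in> orbit"
| swap: "v \<in> orbit \<Longrightarrow> swap v \<in> orbit"

lemma orbit_lightcone: "orbit \<subseteq> lightcone"
proof
  fix v :: vec assume "v \<in> orbit"
  then show "v \<in> lightcone"
  proof induction
    case v_inf show ?case by (simp add: lightcone_def)
  qed (use lattice_isometry_rot lattice_isometry_shift lattice_isometry_swap
      in \<open>auto dest: lattice_isometryD(3)\<close>)
qed

text \<open>The Euclidean algorithm on null vectors. If \<open>\<bar>m\<bar>\<close> or \<open>\<bar>c\<bar>\<close> exceeds \<open>p / 2\<close>, a translation
  of the point of contact by a Gaussian unit brings that coordinate down by \<open>p\<close> in the direction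
  of \<open>0\<close>. Otherwise \<open>p q = m\<^sup>2 + c\<^sup>2 \<le> p\<^sup>2 / 2\<close>, so \<open>q < p\<close>, and the inversion exchanges \<open>p\<close>
  with \<open>q\<close>. Both moves lower the integer \<open>p + \<bar>m\<bar> + \<bar>c\<bar>\<close>, and the descent stops only at \<open>p = 0\<close>.
  The statement speaks of a set \<open>X\<close> closed under the moves so that different descriptions of the
  same spheres can be compared through it.\<close>

lemma orbit_unique:
  assumes int: "\<And>v. v \<in> X \<Longrightarrow> v \<in> int_vecs \<inter> lightcone"
    and inf: "v_inf \<in> X" "\<And>q m c. (0, q, m, c) \<in> X \<Longrightarrow> (0, q, m, c) = v_inf"
    and closed: "\<And>v. v \<in> X \<Longrightarrow> rot v \<in> X" "\<And>v. v \<in> X \<Longrightarrow> shift v \<in> X" "\<And>v. v \<in> X \<Longrightarrow> swap v \<in> X"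
  shows "X = orbit"
proof
  have "v \<in> X" if "v \<in> orbit" for v
    using that by induction (auto intro: inf closed)
  then show "orbit \<subseteq> X" by blast
  have "(p, q, m, c) \<in> orbit"
    if "(p, q, m, c) \<in> X" "n = nat \<lfloor>p + \<bar>m\<bar> + \<bar>c\<bar>\<rfloor>" for n p q m c
    using that
  proof (induction n arbitrary: p q m c rule: less_induct)
    case (less n)
    have ints: "p \<in> \<int>" "q \<in> \<int>" "m \<in> \<int>" "c \<in> \<int>" and lightcone: "0 \<le> p" "0 \<le> q" "p * q = m\<^sup>2 + c\<^sup>2"
      using int[OF less.prems(1)] by (auto simp: int_vecs_def lightcone_def)
    have meas: "nat \<lfloor>p' + \<bar>m'\<bar> + \<bar>c'\<bar>\<rfloor> < n"
      if v': "(p', q', m', c') \<in> X" and lt: "p' + \<bar>m'\<bar> + \<bar>c'\<bar> < p + \<bar>m\<bar> + \<bar>c\<bar>" for p' q' m' c'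
    proof -
      have "p' \<in> \<int>" "m' \<in> \<int>" "c' \<in> \<int>" "0 \<le> p'"
        using int[OF v'] by (auto simp: int_vecs_def lightcone_def)
      then obtain i j where "p' + \<bar>m'\<bar> + \<bar>c'\<bar> = of_int i" "p + \<bar>m\<bar> + \<bar>c\<bar> = of_int j"
        using ints by (metis Ints_abs Ints_add Ints_cases)
      moreover have "0 \<le> p' + \<bar>m'\<bar> + \<bar>c'\<bar>" using \<open>0 \<le> p'\<close> by simp
      ultimately show ?thesis using lt less.prems(2) by simp
    qed
    have smaller: "(p', q', m', c') \<in> orbit"
      if "(p', q', m', c') \<in> X" "p' + \<bar>m'\<bar> + \<bar>c'\<bar> < p + \<bar>m\<bar> + \<bar>c\<bar>" for p' q' m' c'
      using less.IH[OF meas[OF that] that(1) refl] .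
    \<comment> \<open>\<open>m'\<close> and \<open>c'\<close> may be the original coordinates or, after a rotation, the exchanged ones up to sign.\<close>
    have big: "(p, q', m', c') \<in> orbit"
      if v': "(p, q', m', c') \<in> X" and eq: "\<bar>m'\<bar> + \<bar>c'\<bar> = \<bar>m\<bar> + \<bar>c\<bar>"
        and gt: "p < 2 * \<bar>c'\<bar>" and p: "0 < p"
      for q' m' c'
    proof (cases "0 < c'")
      case True
      let ?w = "rot (rot (shift (rot (rot (p, q', m', c')))))"
      have w: "?w = (p, q' - 2 * c' + p, m', c' - p)" by simp
      have "?w \<in> X" by (intro closed v')
      then have "?w \<in> orbit"
        unfolding w by (rule smaller) (use True eq gt p in linarith)
      then have "shift ?w \<in> orbit" by (rule orbit.shift)
      then show ?thesis by (simp only: shift_inverse)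
    next
      case False
      let ?w = "shift (p, q', m', c')"
      have w: "?w = (p, q' + 2 * c' + p, m', c' + p)" by simp
      have "?w \<in> X" by (intro closed v')
      then have "?w \<in> orbit"
        unfolding w by (rule smaller) (use False eq gt p in linarith)
      then have "rot (rot (shift (rot (rot ?w)))) \<in> orbit" by (blast intro: orbit.intros)
      then show ?thesis by (simp only: shift_inverse)
    qed
    consider "p = 0" | "0 < p" "p < 2 * \<bar>c\<bar>" | "0 < p" "p < 2 * \<bar>m\<bar>"
      | "0 < p" "2 * \<bar>c\<bar> \<le> p" "2 * \<bar>m\<bar> \<le> p"
      using lightcone(1) by linarith
    then show ?case
    proof cases
      case 1
      then show ?thesis using less.prems(1) inf(2)[of q m c] orbit.v_inf by simp
    next
      case 2
      then show ?thesis using big[of q m c] less.prems(1) by simp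
    next
      case 3
      have "rot (p, q, m, c) \<in> X" by (intro closed less.prems(1))
      then have "rot (p, q, m, c) \<in> orbit"
        unfolding rot.simps by (rule big) (use 3 in simp_all)
      then have "rot (rot (rot (rot (p, q, m, c)))) \<in> orbit" by (blast intro: orbit.intros)
      then show ?thesis by (simp only: rot_rot_rot_rot)
    next
      case 4
      have "(2 * m)\<^sup>2 \<le> p\<^sup>2" "(2 * c)\<^sup>2 \<le> p\<^sup>2"
        using 4 abs_le_square_iff[of "2 * m" p] abs_le_square_iff[of "2 * c" p] by auto
      then have "p * (2 * q) \<le> p * p"
        using lightcone(3) by (simp add: power2_eq_square)
      then have "q < p" using 4(1) lightcone(2) by (simp add: mult_le_cancel_left)
      have "swap (p, q, m, c) \<in> X" by (intro closed less.prems(1))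
      then have "swap (p, q, m, c) \<in> orbit"
        unfolding swap.simps by (rule smaller) (use \<open>q < p\<close> in simp)
      then have "swap (swap (p, q, m, c)) \<in> orbit" by (rule orbit.swap)
      then show ?thesis by (simp only: swap_swap)
    qed
  qed
  then show "X \<subseteq> orbit" by auto
qed

section \<open>Integrality of octahedra\<close>

text \<open>Octahedra on a triple formed by the given vector and two integral ones are integral.
  Singling out one vector of the triple makes it possible to carry the property along the orbit
  of that vector.\<close>

definition integral_completions :: "vec \<Rightarrow> bool" where
  "integral_completions v\<^sub>1 \<longleftrightarrow> (\<forall>v\<^sub>2 v\<^sub>3 u\<^sub>1 u\<^sub>2 u\<^sub>3.
     octahedron v\<^sub>1 v\<^sub>2 v\<^sub>3 u\<^sub>1 u\<^sub>2 u\<^sub>3 \<longrightarrow> v\<^sub>2 \<in> int_vecs \<longrightarrow> v\<^sub>3 \<in> int_vecs \<longrightarrow> {u\<^sub>1, u\<^sub>2, u\<^sub>3} \<subseteq> int_vecs)"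

lemma integral_completions_isometry:
  assumes "integral_completions v" and g: "lattice_isometry g" "lattice_isometry h"
    and inv: "\<And>v. h (g v) = v" "\<And>v. g (h v) = v"
  shows "integral_completions (g v)"
  unfolding integral_completions_def
proof (intro allI impI)
  fix v\<^sub>2 v\<^sub>3 u\<^sub>1 u\<^sub>2 u\<^sub>3
  assume "octahedron (g v) v\<^sub>2 v\<^sub>3 u\<^sub>1 u\<^sub>2 u\<^sub>3" "v\<^sub>2 \<in> int_vecs" "v\<^sub>3 \<in> int_vecs"
  then have "octahedron v (h v\<^sub>2) (h v\<^sub>3) (h u\<^sub>1) (h u\<^sub>2) (h u\<^sub>3)" "h v\<^sub>2 \<in> int_vecs" "h v\<^sub>3 \<in> int_vecs"
    using octahedron_isometry[OF g(2)] lattice_isometryD(4)[OF g(2)] inv(1) by metis+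
  then have "{h u\<^sub>1, h u\<^sub>2, h u\<^sub>3} \<subseteq> int_vecs"
    using assms(1) unfolding integral_completions_def by blast
  then have "g ` {h u\<^sub>1, h u\<^sub>2, h u\<^sub>3} \<subseteq> int_vecs"
    using lattice_isometryD(4)[OF g(1)] by blast
  then show "{u\<^sub>1, u\<^sub>2, u\<^sub>3} \<subseteq> int_vecs" by (simp add: inv)
qed

lemma int_unit_circle:
  fixes x y :: real
  assumes "x \<in> \<int>" "y \<in> \<int>" "x\<^sup>2 + y\<^sup>2 = 1"
  shows "(x, y) \<in> {(1, 0), (- 1, 0), (0, 1), (0, - 1)}"
proof -
  obtain i j where ij: "x = of_int i" "y = of_int j" using assms by (auto elim!: Ints_cases)
  then have "of_int (i\<^sup>2 + j\<^sup>2) = (of_int 1 :: real)" using assms(3) by simp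
  then have eq: "i\<^sup>2 + j\<^sup>2 = 1" by (simp only: of_int_eq_iff)
  then have "i\<^sup>2 \<le> 1\<^sup>2" "j\<^sup>2 \<le> 1\<^sup>2"
    using zero_le_power2[of i] zero_le_power2[of j] unfolding one_power2 by linarith+
  then have "\<bar>i\<bar> \<le> \<bar>1\<bar>" "\<bar>j\<bar> \<le> \<bar>1\<bar>" by (simp_all only: abs_le_square_iff)
  then have "i \<in> {-1, 0, 1}" "j \<in> {-1, 0, 1}" by auto
  then show ?thesis using eq ij by auto
qed

text \<open>In the plane, a vector orthogonal to two nonzero orthogonal vectors vanishes; the
  determinant of the latter is nonzero by Lagrange's identity.\<close>

lemma orthogonal_triple_2d:
  fixes x y a b c d :: real
  assumes "x * a + y * b = 0" "x * c + y * d = 0" "a * c + b * d = 0"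
    and "(a, b) \<noteq> (0, 0)" "(c, d) \<noteq> (0, 0)"
  shows "x = 0 \<and> y = 0"
proof -
  have "(a * d - b * c)\<^sup>2 + (a * c + b * d)\<^sup>2 = (a\<^sup>2 + b\<^sup>2) * (c\<^sup>2 + d\<^sup>2)"
    by (simp add: power2_eq_square algebra_simps)
  moreover have "a\<^sup>2 + b\<^sup>2 \<noteq> 0" "c\<^sup>2 + d\<^sup>2 \<noteq> 0"
    using assms(4,5) by (auto simp: sum_power2_eq_zero_iff)
  ultimately have "a * d - b * c \<noteq> 0"
    using assms(3) by (metis add.right_neutral mult_eq_0_iff power_zero_numeral)
  moreover have "x * (a * d - b * c) = 0" "y * (a * d - b * c) = 0"
    using assms(1,2) by algebra+
  ultimately show ?thesis by auto
qed

text \<open>Tangency to the plane at height \<open>1\<close> forces the radius \<open>1 / 2\<close>. The point of contact is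
  written relative to a base point \<open>(a, b)\<close>.\<close>

lemma height_one:
  assumes "v \<in> lightcone" "form v_inf v = 1"
  obtains x y where "v = (1, (a + x)\<^sup>2 + (b + y)\<^sup>2, a + x, b + y)"
proof -
  obtain p q m c where v: "v = (p, q, m, c)" by (cases v)
  show thesis
    by (rule that[of "m - a" "c - b"]) (use assms in \<open>simp add: v lightcone_def\<close>)
qed

text \<open>With one vertex the plane \<open>v_inf\<close>, its four neighbours are spheres of radius \<open>1 / 2\<close> whose
  points of contact \<open>0, e, g, f\<close> (relative to that of \<open>v\<^sub>2\<close>) form a rhombus of side \<open>1\<close>, so
  \<open>g = e + f\<close>. The sphere opposite to the plane is tangent to all four, so its point of contact
  is equidistant from the vertices: the rhombus is a square. As \<open>e\<close> is a Gaussian integer of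
  modulus \<open>1\<close>, \<open>f = \<plusminus>\<i> e\<close> is one too, and the sixth sphere has \<open>p = 2\<close> and touches at the centre
  of the square.\<close>

lemma integral_completions_v_inf: "integral_completions v_inf"
  unfolding integral_completions_def
proof (intro allI impI)
  fix v\<^sub>2 v\<^sub>3 u\<^sub>1 u\<^sub>2 u\<^sub>3
  assume oct: "octahedron v_inf v\<^sub>2 v\<^sub>3 u\<^sub>1 u\<^sub>2 u\<^sub>3" and int: "v\<^sub>2 \<in> int_vecs" "v\<^sub>3 \<in> int_vecs"
  have lightcone: "v\<^sub>2 \<in> lightcone" "v\<^sub>3 \<in> lightcone" "u\<^sub>3 \<in> lightcone" "u\<^sub>2 \<in> lightcone"
    and height: "form v_inf v\<^sub>2 = 1" "form v_inf v\<^sub>3 = 1" "form v_inf u\<^sub>3 = 1" "form v_inf u\<^sub>2 = 1"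
    using oct by (simp_all only: octahedron_def insert_subset)
  obtain a b where v2: "v\<^sub>2 = (1, a\<^sup>2 + b\<^sup>2, a, b)"
    using height_one[OF lightcone(1) height(1), of 0 0] by auto
  obtain e e' where v3: "v\<^sub>3 = (1, (a + e)\<^sup>2 + (b + e')\<^sup>2, a + e, b + e')"
    by (rule height_one[OF lightcone(2) height(2)])
  obtain f f' where u3: "u\<^sub>3 = (1, (a + f)\<^sup>2 + (b + f')\<^sup>2, a + f, b + f')"
    by (rule height_one[OF lightcone(3) height(3)])
  obtain g g' where u2: "u\<^sub>2 = (1, (a + g)\<^sup>2 + (b + g')\<^sup>2, a + g, b + g')"
    by (rule height_one[OF lightcone(4) height(4)])
  obtain p q m c where u1: "u\<^sub>1 = (p, q, m, c)" by (cases u\<^sub>1)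
  have e: "e\<^sup>2 + e'\<^sup>2 = 1" and f: "f\<^sup>2 + f'\<^sup>2 = 1"
    and eg: "(g - e)\<^sup>2 + (g' - e')\<^sup>2 = 1" and fg: "(g - f)\<^sup>2 + (g' - f')\<^sup>2 = 1"
    using oct by (simp_all add: octahedron_def v2 v3 u2 u3 power2_eq_square algebra_simps)
  have g: "(g, g') \<noteq> (0, 0)" and ef: "(e, e') \<noteq> (f, f')"
    using oct by (auto simp: octahedron_def v2 v3 u2 u3)
  have u1_null: "p * q = m\<^sup>2 + c\<^sup>2"
    and u1_2: "p * (a\<^sup>2 + b\<^sup>2) + q - 2 * m * a - 2 * c * b = 1"
    and u1_3: "p * ((a + e)\<^sup>2 + (b + e')\<^sup>2) + q - 2 * m * (a + e) - 2 * c * (b + e') = 1"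
    and u1_4: "p * ((a + f)\<^sup>2 + (b + f')\<^sup>2) + q - 2 * m * (a + f) - 2 * c * (b + f') = 1"
    and u1_5: "p * ((a + g)\<^sup>2 + (b + g')\<^sup>2) + q - 2 * m * (a + g) - 2 * c * (b + g') = 1"
    using oct by (simp_all add: octahedron_def lightcone_def v2 v3 u2 u3 u1 algebra_simps)
  have p: "p \<noteq> 0"
  proof
    assume "p = 0"
    then have "m = 0" "c = 0" using u1_null by (auto simp: sum_power2_eq_zero_iff)
    with u1_2 \<open>p = 0\<close> have "u\<^sub>1 = v_inf" by (simp add: u1)
    then show False using oct by (simp add: octahedron_def)
  qed
  have ee: "(e, e') \<in> {(1, 0), (- 1, 0), (0, 1), (0, - 1)}"
  proof (intro int_unit_circle e)
    have "(a + e) - a \<in> \<int>" "(b + e') - b \<in> \<int>"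
      using int unfolding v2 v3 int_vecs_def by (auto intro!: Ints_diff)
    then show "e \<in> \<int>" "e' \<in> \<int>" by simp_all
  qed
  have "g - (e + f) = 0 \<and> g' - (e' + f') = 0"
  proof (rule orthogonal_triple_2d[where a = "e - f" and b = "e' - f'" and c = g and d = g'])
    show "(g - (e + f)) * (e - f) + (g' - (e' + f')) * (e' - f') = 0" "(e - f) * g + (e' - f') * g' = 0"
      "(g - (e + f)) * g + (g' - (e' + f')) * g' = 0"
      using e f eg fg by algebra+
  qed (use g ef in auto)
  then have g_eq: "g = e + f" "g' = e' + f'" by simp_all
  \<comment> \<open>The numerator of the point of contact of \<open>u\<^sub>1\<close>, relative to that of \<open>v\<^sub>2\<close>.\<close>
  define x y where "x = m - p * a" and "y = c - p * b"
  have xy: "x\<^sup>2 + y\<^sup>2 = p"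
    using u1_null u1_2 unfolding x_def y_def by algebra
  have xe: "2 * (x * e + y * e') = p"
    using u1_2 u1_3 e unfolding x_def y_def by algebra
  have xf: "2 * (x * f + y * f') = p"
    using u1_2 u1_4 f unfolding x_def y_def by algebra
  have "p * (g\<^sup>2 + g'\<^sup>2) = 2 * (x * g + y * g')"
    using u1_2 u1_5 unfolding x_def y_def by algebra
  also have "\<dots> = 2 * p" using xe xf unfolding g_eq by (simp add: distrib_left)
  finally have "g\<^sup>2 + g'\<^sup>2 = 2" using p by simp
  \<comment> \<open>The diagonals have the same length, so the rhombus is a square.\<close>
  then have perp: "e * f + e' * f' = 0"
    using e f unfolding g_eq by (simp add: power2_sum)
  have "p = 2 \<and> x = g \<and> y = g' \<and> f \<in> \<int> \<and> f' \<in> \<int> \<and> e \<in> \<int> \<and> e' \<in> \<int>"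
  proof -
    have ff: "(f, f') = (e', - e) \<or> (f, f') = (- e', e)"
      using ee perp f by (auto simp: power2_eq_1_iff)
    have g2: "2 * x = p * g" "2 * y = p * g'"
      using ee ff xe xf by (auto simp: g_eq)
    have "4 * p = (2 * x)\<^sup>2 + (2 * y)\<^sup>2" using xy by simp
    also have "\<dots> = p * p * (g\<^sup>2 + g'\<^sup>2)"
      unfolding g2 by (simp add: power2_eq_square algebra_simps)
    finally have "p * p = 2 * p" using \<open>g\<^sup>2 + g'\<^sup>2 = 2\<close> by simp
    then have "p = 2" using p by simp
    then show ?thesis
      using ee ff g2 by (auto simp: g_eq)
  qed
  then have p2: "p = 2" "m = 2 * a + g" "c = 2 * b + g'" and ints: "f \<in> \<int>" "f' \<in> \<int>" "e \<in> \<int>" "e' \<in> \<int>"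
    by (auto simp: x_def y_def)
  have ab: "a \<in> \<int>" "b \<in> \<int>" using int(1) by (auto simp: v2 int_vecs_def)
  have "q = 1 + 2 * m * a + 2 * c * b - p * (a\<^sup>2 + b\<^sup>2)" using u1_2 by simp
  with p2 ab ints show "{u\<^sub>1, u\<^sub>2, u\<^sub>3} \<subseteq> int_vecs"
    by (simp add: u1 u2 u3 int_vecs_def g_eq)
qed

lemma integral_completions_orbit:
  assumes "v \<in> orbit"
  shows "integral_completions v"
  using assms
proof induction
  case v_inf show ?case by (rule integral_completions_v_inf)
next
  case (rot v)
  note i = lattice_isometry_rot
  from rot.IH i lattice_isometry_comp[OF i lattice_isometry_comp[OF i i]] show ?case
    by (rule integral_completions_isometry) (rule rot_rot_rot_rot)+
next
  case (shift v)
  note i = lattice_isometry_rot and j = lattice_isometry_shift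
  note rr = lattice_isometry_comp[OF i i]
  from shift.IH j lattice_isometry_comp[OF rr lattice_isometry_comp[OF j rr]] show ?case
    by (rule integral_completions_isometry) (rule shift_inverse)+
next
  case (swap v)
  from swap.IH lattice_isometry_swap lattice_isometry_swap show ?case
    by (rule integral_completions_isometry) (rule swap_swap)+
qed

section \<open>Primitive null vectors and the generated spheres\<close>

definition prim_vecs :: "vec set" where
  "prim_vecs = {v \<in> lightcone. \<exists>p q m c :: int. v = (of_int p, of_int q, of_int m, of_int c) \<and>
     (\<forall>d. d dvd p \<longrightarrow> d dvd q \<longrightarrow> d dvd m \<longrightarrow> d dvd c \<longrightarrow> is_unit d)}"

lemma prim_vecsI:
  assumes "v \<in> lightcone" "v = (of_int p, of_int q, of_int m, of_int c)"
    and "\<And>d. d dvd p \<Longrightarrow> d dvd q \<Longrightarrow> d dvd m \<Longrightarrow> d dvd c \<Longrightarrow> is_unit d"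
  shows "v \<in> prim_vecs"
  unfolding prim_vecs_def using assms by blast

lemma prim_vecsE:
  assumes "v \<in> prim_vecs"
  obtains p q m c :: int where "v \<in> lightcone" "v = (of_int p, of_int q, of_int m, of_int c)"
    and "\<forall>d. d dvd p \<longrightarrow> d dvd q \<longrightarrow> d dvd m \<longrightarrow> d dvd c \<longrightarrow> is_unit d"
  using assms unfolding prim_vecs_def by blast

lemma prim_vecs_eq_orbit: "prim_vecs = orbit"
proof (rule orbit_unique)
  fix v :: vec assume v: "v \<in> prim_vecs"
  then obtain p q m c :: int where v_lc: "v \<in> lightcone"
    and v_eq: "v = (of_int p, of_int q, of_int m, of_int c)"
    and prim: "\<forall>d. d dvd p \<longrightarrow> d dvd q \<longrightarrow> d dvd m \<longrightarrow> d dvd c \<longrightarrow> is_unit d"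
    by (rule prim_vecsE)
  show "v \<in> int_vecs \<inter> lightcone"
    using v_lc by (simp add: v_eq int_vecs_def)
  show "rot v \<in> prim_vecs"
  proof (rule prim_vecsI)
    show "rot v = (of_int p, of_int q, of_int (- c), of_int m)" by (simp add: v_eq)
  qed (use prim lattice_isometryD(3)[OF lattice_isometry_rot v_lc] in auto)
  show "swap v \<in> prim_vecs"
  proof (rule prim_vecsI)
    show "swap v = (of_int q, of_int p, of_int m, of_int (- c))" by (simp add: v_eq)
  qed (use prim lattice_isometryD(3)[OF lattice_isometry_swap v_lc] in auto)
  show "shift v \<in> prim_vecs"
  proof (rule prim_vecsI)
    show "shift v = (of_int p, of_int (q + 2 * c + p), of_int m, of_int (c + p))" by (simp add: v_eq)
  next
    fix d assume d: "d dvd p" "d dvd q + 2 * c + p" "d dvd m" "d dvd c + p"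
    then have "d dvd c" by (simp add: dvd_add_left_iff)
    moreover have "d dvd q" using d calculation by (simp add: dvd_add_left_iff)
    ultimately show "is_unit d" using prim d by blast
  qed (use lattice_isometryD(3)[OF lattice_isometry_shift v_lc] in auto)
next
  show "v_inf \<in> prim_vecs"
    by (rule prim_vecsI[of _ 0 1 0 0]) (auto simp: lightcone_def)
next
  fix q m c assume "(0, q, m, c) \<in> prim_vecs"
  then obtain p' q' m' c' :: int where v: "(0, q, m, c) \<in> lightcone"
      "(0 :: real, q, m, c) = (of_int p', of_int q', of_int m', of_int c')"
    and prim: "\<forall>d. d dvd p' \<longrightarrow> d dvd q' \<longrightarrow> d dvd m' \<longrightarrow> d dvd c' \<longrightarrow> is_unit d"
    by (rule prim_vecsE)
  then have "m = 0" "c = 0" "0 < q" by (auto simp: lightcone_def sum_power2_eq_zero_iff)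
  with v(2) prim[rule_format, of q'] have "is_unit q'" "0 < q'" by simp_all
  then have "q' = 1" by simp
  then show "(0, q, m, c) = v_inf" using v(2) \<open>m = 0\<close> \<open>c = 0\<close> by simp
qed

text \<open>A common divisor of the entries of \<open>u\<close> divides \<open>form v u\<close>.\<close>

lemma int_vecs_form_one_prim:
  assumes "v \<in> int_vecs" "u \<in> int_vecs" "u \<in> lightcone" "form v u = 1"
  shows "u \<in> prim_vecs"
proof -
  obtain p q m c where v: "v = (of_int p, of_int q, of_int m, of_int c)"
    using assms(1) by (auto simp: int_vecs_def elim!: Ints_cases)
  obtain p' q' m' c' where u: "u = (of_int p', of_int q', of_int m', of_int c')"
    using assms(2) by (auto simp: int_vecs_def elim!: Ints_cases)
  have "of_int (p * q' + q * p' - 2 * m * m' - 2 * c * c') = (of_int 1 :: real)"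
    using assms(4) by (simp add: v u)
  then have eq: "p * q' + q * p' - 2 * m * m' - 2 * c * c' = 1" by (simp only: of_int_eq_iff)
  show ?thesis
  proof (rule prim_vecsI[OF assms(3) u])
    fix d assume "d dvd p'" "d dvd q'" "d dvd m'" "d dvd c'"
    then have "d dvd p * q' + q * p' - 2 * m * m' - 2 * c * c'"
      by (intro dvd_diff dvd_add dvd_mult)
    then show "is_unit d" by (simp only: eq)
  qed
qed

lemma start_orbit: "{v_zero, v_one, v_inf} \<subseteq> orbit"
proof -
  have "swap v_inf = v_zero" "rot (rot (rot (shift v_zero))) = v_one" by simp_all
  then show ?thesis using orbit.intros by (metis empty_subsetI insert_subset)
qed

lemma orbit_octahedron:
  assumes oct: "octahedron v\<^sub>1 v\<^sub>2 v\<^sub>3 u\<^sub>1 u\<^sub>2 u\<^sub>3" and v: "{v\<^sub>1, v\<^sub>2, v\<^sub>3} \<subseteq> orbit"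
  shows "{u\<^sub>1, u\<^sub>2, u\<^sub>3} \<subseteq> orbit"
proof -
  have int: "w \<in> int_vecs" if "w \<in> orbit" for w
    using that unfolding prim_vecs_eq_orbit[symmetric]
    by (elim prim_vecsE) (simp add: int_vecs_def)
  have "integral_completions v\<^sub>1" using v by (intro integral_completions_orbit) simp
  then have "{u\<^sub>1, u\<^sub>2, u\<^sub>3} \<subseteq> int_vecs"
    using oct v int unfolding integral_completions_def by blast
  moreover have "{u\<^sub>1, u\<^sub>2, u\<^sub>3} \<subseteq> lightcone" "form v\<^sub>2 u\<^sub>1 = 1" "form v\<^sub>1 u\<^sub>2 = 1" "form v\<^sub>1 u\<^sub>3 = 1"
    using oct by (simp_all only: octahedron_def insert_subset simp_thms empty_subsetI)
  ultimately have "u\<^sub>1 \<in> prim_vecs" "u\<^sub>2 \<in> prim_vecs" "u\<^sub>3 \<in> prim_vecs"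
    using int_vecs_form_one_prim[OF int] v unfolding insert_subset by blast+
  then show ?thesis by (simp add: prim_vecs_eq_orbit)
qed

text \<open>The vectors \<open>w\<close> with \<open>g w\<close> generated form a set closed under octahedra; if it contains the
  start, then by minimality it contains everything that is generated. So invariance under \<open>g\<close>
  need only be tested on the three starting vectors.\<close>

lemma G_i_isometry:
  assumes g: "lattice_isometry g"
    and start: "sph (g v_zero) \<in> G_i" "sph (g v_one) \<in> G_i" "sph (g v_inf) \<in> G_i"
    and v: "v \<in> lightcone" "sph v \<in> G_i"
  shows "sph (g v) \<in> G_i"
proof -
  let ?C = "{w \<in> lightcone. sph (g w) \<in> G_i}"
  have "G_i \<subseteq> sph ` ?C"
  proof (rule G_i_minimal)
    show "{v_zero, v_one, v_inf} \<subseteq> ?C"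
      using start by (simp add: lightcone_def)
  next
    fix v\<^sub>1 v\<^sub>2 v\<^sub>3 u\<^sub>1 u\<^sub>2 u\<^sub>3
    assume oct: "octahedron v\<^sub>1 v\<^sub>2 v\<^sub>3 u\<^sub>1 u\<^sub>2 u\<^sub>3" and "{v\<^sub>1, v\<^sub>2, v\<^sub>3} \<subseteq> ?C"
    then have "{sph (g u\<^sub>1), sph (g u\<^sub>2), sph (g u\<^sub>3)} \<subseteq> G_i"
      by (intro G_i_octahedron[OF octahedron_isometry[OF g oct]]) auto
    moreover have "{u\<^sub>1, u\<^sub>2, u\<^sub>3} \<subseteq> lightcone"
      using oct by (simp only: octahedron_def insert_subset simp_thms empty_subsetI)
    ultimately show "{u\<^sub>1, u\<^sub>2, u\<^sub>3} \<subseteq> ?C" by simp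
  qed auto
  then obtain w where "w \<in> ?C" "sph v = sph w" using v(2) by blast
  then show ?thesis using sph_inject[OF v(1), of w] by (simp del: sph.simps)
qed

lemma start_G_i: "sph v_zero \<in> G_i" "sph v_one \<in> G_i" "sph v_inf \<in> G_i"
proof -
  have "start \<subseteq> G_i" unfolding G_i_def by blast
  then show "sph v_zero \<in> G_i" "sph v_one \<in> G_i" "sph v_inf \<in> G_i"
    unfolding start_eq by (simp_all only: insert_subset)
qed

text \<open>All images of the starting triple under the three generators of the symmetry group already
  lie in the first octahedron, the one with equator \<open>0, 1, 1 + \<i>, \<i>\<close> below the plane.\<close>

lemma G_i_eq: "G_i = sph ` orbit"
proof
  show "G_i \<subseteq> sph ` orbit"
    using orbit_lightcone start_orbit orbit_octahedron by (rule G_i_minimal)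
  have "octahedron v_inf v_zero v_one (2, 1, 1, 1) (1, 2, 1, 1) (1, 1, 0, 1)"
    by (simp add: octahedron_def lightcone_def)
  then have "{sph (2, 1, 1, 1), sph (1, 2, 1, 1), sph (1, 1, 0, 1)} \<subseteq> G_i"
    by (rule G_i_octahedron) (simp only: start_G_i insert_subset empty_subsetI simp_thms)
  then have first: "sph (1, 2, 1, 1) \<in> G_i" "sph (1, 1, 0, 1) \<in> G_i"
    by (simp_all only: insert_subset)
  have "sph v \<in> G_i" if "v \<in> orbit" for v
    using that
  proof induction
    case v_inf show ?case by (rule start_G_i)
  next
    case (rot v)
    have "rot v_zero = v_zero" "rot v_one = (1, 1, 0, 1)" "rot v_inf = v_inf" by simp_all
    then have "sph (rot v_zero) \<in> G_i" "sph (rot v_one) \<in> G_i" "sph (rot v_inf) \<in> G_i"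
      by (simp_all only: first start_G_i)
    moreover have "v \<in> lightcone" using rot.hyps orbit_lightcone by blast
    ultimately show ?case
      using rot.IH by (rule G_i_isometry[OF lattice_isometry_rot])
  next
    case (shift v)
    have "shift v_zero = (1, 1, 0, 1)" "shift v_one = (1, 2, 1, 1)" "shift v_inf = v_inf" by simp_all
    then have "sph (shift v_zero) \<in> G_i" "sph (shift v_one) \<in> G_i" "sph (shift v_inf) \<in> G_i"
      by (simp_all only: first start_G_i)
    moreover have "v \<in> lightcone" using shift.hyps orbit_lightcone by blast
    ultimately show ?case
      using shift.IH by (rule G_i_isometry[OF lattice_isometry_shift])
  next
    case (swap v)
    have "swap v_zero = v_inf" "swap v_one = v_one" "swap v_inf = v_zero" by simp_all
    then have "sph (swap v_zero) \<in> G_i" "sph (swap v_one) \<in> G_i" "sph (swap v_inf) \<in> G_i"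
      by (simp_all only: start_G_i)
    moreover have "v \<in> lightcone" using swap.hyps orbit_lightcone by blast
    ultimately show ?case
      using swap.IH by (rule G_i_isometry[OF lattice_isometry_swap])
  qed
  then show "sph ` orbit \<subseteq> G_i" by blast
qed

section \<open>Coprime pairs of Gaussian integers\<close>

text \<open>The rank one Hermitian matrix \<open>(\<alpha>, \<beta>) (\<alpha>, \<beta>)\<^sup>*\<close>.\<close>

definition pair_vec :: "complex \<Rightarrow> complex \<Rightarrow> vec" where
  "pair_vec \<alpha> \<beta> = ((norm \<beta>)\<^sup>2, (norm \<alpha>)\<^sup>2, Re (\<alpha> * cnj \<beta>), Im (\<alpha> * cnj \<beta>))"

definition coprime_vecs :: "vec set" where
  "coprime_vecs = {pair_vec \<alpha> \<beta> |\<alpha> \<beta>. \<alpha> \<in> gauss_ints \<and> \<beta> \<in> gauss_ints \<and> gauss_coprime \<alpha> \<beta>}"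

lemma gauss_ints_closed:
  "0 \<in> gauss_ints" "1 \<in> gauss_ints" "\<i> \<in> gauss_ints"
  "x \<in> gauss_ints \<Longrightarrow> y \<in> gauss_ints \<Longrightarrow> x + y \<in> gauss_ints"
  "x \<in> gauss_ints \<Longrightarrow> y \<in> gauss_ints \<Longrightarrow> x * y \<in> gauss_ints"
  by (simp_all add: gauss_ints_def)

lemma norm_sq_gauss_int: "x \<in> gauss_ints \<Longrightarrow> (norm x)\<^sup>2 \<in> \<int>"
  by (simp add: gauss_ints_def cmod_power2)

lemma gauss_dvd_add_mult:
  assumes "gauss_dvd \<delta> x" "gauss_dvd \<delta> y" "k \<in> gauss_ints"
  shows "gauss_dvd \<delta> (x + k * y)"
proof -
  obtain a b where "a \<in> gauss_ints" "b \<in> gauss_ints" "x = \<delta> * a" "y = \<delta> * b"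
    using assms by (auto simp: gauss_dvd_def)
  then have "x + k * y = \<delta> * (a + k * b)" "a + k * b \<in> gauss_ints"
    using assms(3) by (auto simp: algebra_simps gauss_ints_closed)
  then show ?thesis unfolding gauss_dvd_def by blast
qed

lemma gauss_coprime_transfer:
  assumes "gauss_coprime \<alpha> \<beta>"
    and "\<And>\<delta>. gauss_dvd \<delta> \<alpha>' \<Longrightarrow> gauss_dvd \<delta> \<beta>' \<Longrightarrow> gauss_dvd \<delta> \<alpha> \<and> gauss_dvd \<delta> \<beta>"
  shows "gauss_coprime \<alpha>' \<beta>'"
  using assms unfolding gauss_coprime_def by blast

lemma gauss_dvd_refl: "gauss_dvd x x" and gauss_dvd_0: "gauss_dvd x 0"
  using gauss_ints_closed(1,2) by (force simp: gauss_dvd_def)+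

text \<open>Such an \<open>\<alpha>\<close> is a unit, so its squared modulus is a positive integer dividing \<open>1\<close>.\<close>

lemma gauss_coprime_0:
  assumes "\<alpha> \<in> gauss_ints" "gauss_coprime \<alpha> 0"
  shows "norm \<alpha> = 1"
proof -
  obtain k where k: "k \<in> gauss_ints" "1 = \<alpha> * k"
    using assms gauss_dvd_refl gauss_dvd_0 unfolding gauss_coprime_def gauss_dvd_def by meson
  obtain i j where ij: "(norm \<alpha>)\<^sup>2 = of_int i" "(norm k)\<^sup>2 = of_int j"
    using norm_sq_gauss_int[OF assms(1)] norm_sq_gauss_int[OF k(1)] by (auto elim!: Ints_cases)
  have "(norm \<alpha>)\<^sup>2 * (norm k)\<^sup>2 = 1"
    by (simp flip: power_mult_distrib norm_mult k(2))
  then have "of_int (i * j) = (of_int 1 :: real)" by (simp add: ij)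
  then have "i * j = 1" by (simp only: of_int_eq_iff)
  moreover have "0 \<le> i" using ij(1) by (metis of_int_0_le_iff zero_le_power2)
  ultimately have "i = 1" by (metis abs_of_nonneg dvd_triv_left zdvd1_eq)
  then show ?thesis using ij(1) norm_ge_zero[of \<alpha>] by (simp add: power2_eq_1_iff)
qed

text \<open>On pairs, the three symmetries are \<open>(\<i> \<alpha>, \<beta>)\<close>, \<open>(\<alpha> + \<i> \<beta>, \<beta>)\<close> and \<open>(\<beta>, \<alpha>)\<close>, and none of
  them changes the common divisors.\<close>

lemma coprime_vecs_eq_orbit: "coprime_vecs = orbit"
proof (rule orbit_unique)
  fix v :: vec assume v: "v \<in> coprime_vecs"
  then obtain \<alpha> \<beta> where ab: "\<alpha> \<in> gauss_ints" "\<beta> \<in> gauss_ints" and co: "gauss_coprime \<alpha> \<beta>"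
    and v: "v = pair_vec \<alpha> \<beta>"
    by (auto simp: coprime_vecs_def)
  have "\<not> gauss_coprime 0 0"
    using gauss_coprime_0[of 0] gauss_ints_closed(1) by auto
  then have "\<alpha> \<noteq> 0 \<or> \<beta> \<noteq> 0" using co by auto
  then have "0 < (norm \<beta>)\<^sup>2 + (norm \<alpha>)\<^sup>2"
    by (auto simp: sum_power2_gt_zero_iff)
  moreover have "(norm \<beta>)\<^sup>2 * (norm \<alpha>)\<^sup>2 = (Re (\<alpha> * cnj \<beta>))\<^sup>2 + (Im (\<alpha> * cnj \<beta>))\<^sup>2"
    unfolding cmod_power2[symmetric] by (simp add: norm_mult power_mult_distrib)
  ultimately have "v \<in> lightcone" by (simp add: v pair_vec_def lightcone_def)
  moreover have "v \<in> int_vecs"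
    using ab norm_sq_gauss_int[OF ab(1)] norm_sq_gauss_int[OF ab(2)]
    by (simp add: v pair_vec_def int_vecs_def gauss_ints_def)
  ultimately show "v \<in> int_vecs \<inter> lightcone" by blast
  have "rot v = pair_vec (\<i> * \<alpha>) \<beta>"
    by (simp add: v pair_vec_def norm_mult)
  moreover have "gauss_coprime (\<i> * \<alpha>) \<beta>"
    using co
  proof (rule gauss_coprime_transfer)
    fix \<delta> assume d: "gauss_dvd \<delta> (\<i> * \<alpha>)" "gauss_dvd \<delta> \<beta>"
    have "gauss_dvd \<delta> (0 + (- \<i>) * (\<i> * \<alpha>))"
      by (intro gauss_dvd_add_mult gauss_dvd_0 d) (simp add: gauss_ints_def)
    then show "gauss_dvd \<delta> \<alpha> \<and> gauss_dvd \<delta> \<beta>" using d by simp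
  qed
  ultimately show "rot v \<in> coprime_vecs"
    using ab gauss_ints_closed unfolding coprime_vecs_def by blast
  have "shift v = pair_vec (\<alpha> + \<i> * \<beta>) \<beta>"
    unfolding v pair_vec_def shift.simps cmod_power2
    by (simp add: power2_eq_square algebra_simps)
  moreover have "gauss_coprime (\<alpha> + \<i> * \<beta>) \<beta>"
    using co
  proof (rule gauss_coprime_transfer)
    fix \<delta> assume d: "gauss_dvd \<delta> (\<alpha> + \<i> * \<beta>)" "gauss_dvd \<delta> \<beta>"
    have "gauss_dvd \<delta> ((\<alpha> + \<i> * \<beta>) + (- \<i>) * \<beta>)"
      by (intro gauss_dvd_add_mult d) (simp add: gauss_ints_def)
    then show "gauss_dvd \<delta> \<alpha> \<and> gauss_dvd \<delta> \<beta>" using d by simp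
  qed
  ultimately show "shift v \<in> coprime_vecs"
    using ab gauss_ints_closed unfolding coprime_vecs_def by blast
  have "swap v = pair_vec \<beta> \<alpha>"
    by (simp add: v pair_vec_def algebra_simps)
  moreover have "gauss_coprime \<beta> \<alpha>"
    using co by (rule gauss_coprime_transfer) blast
  ultimately show "swap v \<in> coprime_vecs"
    using ab unfolding coprime_vecs_def by blast
next
  have "v_inf = pair_vec 1 0" by (simp add: pair_vec_def)
  moreover have "gauss_coprime 1 0" by (simp add: gauss_coprime_def)
  ultimately show "v_inf \<in> coprime_vecs"
    using gauss_ints_closed(1,2) unfolding coprime_vecs_def by blast
next
  fix q m c assume "(0, q, m, c) \<in> coprime_vecs"
  then obtain \<alpha> \<beta> where "\<alpha> \<in> gauss_ints" "gauss_coprime \<alpha> \<beta>" "(0, q, m, c) = pair_vec \<alpha> \<beta>"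
    unfolding coprime_vecs_def by blast
  then show "(0, q, m, c) = v_inf"
    using gauss_coprime_0[of \<alpha>] by (simp add: pair_vec_def)
qed

lemma Sab_eq_sph:
  assumes "\<alpha> \<in> gauss_ints" "gauss_coprime \<alpha> \<beta>"
  shows "Sab \<alpha> \<beta> = sph (pair_vec \<alpha> \<beta>)"
proof (cases "\<beta> = 0")
  case True
  then show ?thesis using gauss_coprime_0 assms by (simp add: Sab_def pair_vec_def)
next
  case False
  have "Complex (Re (\<alpha> * cnj \<beta>)) (Im (\<alpha> * cnj \<beta>)) / of_real ((norm \<beta>)\<^sup>2) = \<alpha> / \<beta>"
    using False unfolding complex_surj complex_norm_square by simp
  then show ?thesis using False by (simp add: Sab_def pair_vec_def del: of_real_power)
qed

lemma P_i_eq: "P_i = sph ` orbit"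
  unfolding coprime_vecs_eq_orbit[symmetric] P_i_def coprime_vecs_def
  using Sab_eq_sph by (auto simp: image_iff) metis+

section \<open>The Moebius image of the second family\<close>

text \<open>The equation \<open>\<bar>z\<bar>\<^sup>2 + t\<^sup>2 - 2 Re (z cnj z\<^sub>0) + \<bar>z\<^sub>0\<bar>\<^sup>2 = 2 r t\<close> of a normal sphere,
  multiplied by \<open>p\<close>. It is linear in the null vector and at \<open>p = 0\<close> becomes the equation of a
  plane, so that a Poincare extension acts linearly on its coefficients.\<close>

fun on_sph :: "vec \<Rightarrow> complex \<times> real \<Rightarrow> bool" where
  "on_sph (p, q, m, c) (z, t) \<longleftrightarrow>
     p * ((Re z)\<^sup>2 + (Im z)\<^sup>2 + t\<^sup>2) - 2 * (m * Re z + c * Im z) + q = t"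

lemma upper_sph:
  assumes "v \<in> lightcone"
  shows "{x \<in> sph v. snd x > 0} = {x. snd x > 0 \<and> on_sph v x}"
  using assms
proof (cases rule: lightcone_cases)
  case (plane h)
  then show ?thesis by (auto simp: Plane_def)
next
  case (sphere p m c)
  have "(z, t) \<in> Sph (Complex m c / of_real p) (1 / (2 * p)) \<longleftrightarrow> on_sph v (z, t)" for z t
  proof -
    have "(z, t) \<in> Sph (Complex m c / of_real p) (1 / (2 * p)) \<longleftrightarrow>
        (Re z - m / p)\<^sup>2 + (Im z - c / p)\<^sup>2 + t\<^sup>2 = t / p"
      using sphere(1) by (simp add: mem_Sph cmod_power2)
    also have "(Re z - m / p)\<^sup>2 + (Im z - c / p)\<^sup>2 + t\<^sup>2 =
        (p * ((Re z)\<^sup>2 + (Im z)\<^sup>2 + t\<^sup>2) - 2 * (m * Re z + c * Im z) + (m\<^sup>2 + c\<^sup>2) / p) / p"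
      using sphere(1) by (simp add: field_simps power2_eq_square)
    also have "\<dots> = t / p \<longleftrightarrow> on_sph v (z, t)"
      using sphere(1) by (simp add: sphere(2))
    finally show ?thesis .
  qed
  then show ?thesis unfolding sphere(3) by auto
qed

text \<open>For a sphere, the only point removed is the point of contact. It is recovered by the
  closure because a connected set with more than one point has no isolated points.\<close>

lemma closure_upper_sph:
  assumes "v \<in> lightcone"
  shows "closure {x \<in> sph v. snd x > 0} = sph v"
  using assms
proof (cases rule: lightcone_cases)
  case (plane h)
  have "{x \<in> Plane h. snd x > 0} = Plane h" "closed (Plane h)"
    using plane(1) by (auto simp: Plane_def closed_Times)
  then show ?thesis unfolding plane(3) by simp
next
  case (sphere p m c)
  define z r where "z = Complex m c / of_real p" and "r = 1 / (2 * p)"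
  have r: "0 < r" using sphere(1) by (simp add: r_def)
  have upper: "{x \<in> Sph z r. snd x > 0} = Sph z r - {(z, 0)}"
  proof -
    have "t > 0 \<longleftrightarrow> (w, t) \<noteq> (z, 0)" if "(w, t) \<in> Sph z r" for w t
    proof -
      have eq: "(norm (w - z))\<^sup>2 + t\<^sup>2 = 2 * r * t" using that by (simp add: mem_Sph)
      then have "0 \<le> 2 * r * t" by (metis sum_power2_ge_zero)
      then have "0 \<le> t" using r by (simp add: zero_le_mult_iff)
      with eq show ?thesis by (cases "t = 0") auto
    qed
    then show ?thesis by auto
  qed
  have "connected (Sph z r)"
    unfolding Sph_def by (rule connected_sphere) simp
  moreover have bottom: "(z, 0) \<in> Sph z r" and "(z, 2 * r) \<in> Sph z r" "2 * r \<noteq> 0"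
    using r by (auto simp: mem_Sph power2_eq_square)
  ultimately have "(z, 0) islimpt Sph z r"
    by (intro connected_imp_perfect) auto
  then have "(z, 0) \<in> closure (Sph z r - {(z, 0)})"
    by (simp add: islimpt_in_closure)
  moreover have "closed (Sph z r)" by (simp add: Sph_def)
  ultimately have "closure (Sph z r - {(z, 0)}) = Sph z r"
    using closure_minimal[of "Sph z r - {(z, 0)}" "Sph z r"]
      closure_subset[of "Sph z r - {(z, 0)}"] by auto
  then show ?thesis
    unfolding sphere(3) z_def[symmetric] r_def[symmetric] upper .
qed

text \<open>Here \<open>N = \<bar>z\<bar>\<^sup>2 + t\<^sup>2\<close> and \<open>D = \<bar>1 - z\<bar>\<^sup>2 + t\<^sup>2\<close>, and the first entry is
  \<open>\<i> cnj \<omega> (z - N) / D\<close>.\<close>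

lemma M_ext_Complex:
  fixes x y t :: real
  assumes "t > 0"
  defines "N \<equiv> x\<^sup>2 + y\<^sup>2 + t\<^sup>2"
  defines "D \<equiv> 1 - 2 * x + N"
  shows "M_ext (Complex x y, t) =
      (Complex ((sqrt 3 * (x - N) + y) / (2 * D)) ((sqrt 3 * y - (x - N)) / (2 * D)), t / D)"
    and "D > 0"
proof -
  have D: "D = (1 - x)\<^sup>2 + y\<^sup>2 + t\<^sup>2"
    by (simp add: D_def N_def power2_eq_square algebra_simps)
  show "D > 0" using assms(1) by (simp add: D add_nonneg_pos)
  have norm_omega: "norm omega = 1"
    by (simp add: omega_def cmod_def power_divide norm_divide)
  have eq: "- omega * Complex x y + omega = omega * Complex (1 - x) (- y)"
    by (simp add: complex_eq_iff algebra_simps)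
  have D': "(norm (- omega * Complex x y + omega))\<^sup>2 + (norm (- omega))\<^sup>2 * t\<^sup>2 = D"
    unfolding eq by (simp add: norm_mult norm_omega cmod_power2 D)
  have num: "(\<i> * Complex x y + 0) * cnj (- omega * Complex x y + omega) +
      \<i> * cnj (- omega) * of_real (t\<^sup>2)
      = Complex ((sqrt 3 * (x - N) + y) / 2) ((sqrt 3 * y - (x - N)) / 2)"
    by (simp add: complex_eq_iff omega_def N_def power2_eq_square field_simps)
  have det: "norm (\<i> * omega - 0 * - omega) = 1"
    by (simp add: norm_mult norm_omega)
  show "M_ext (Complex x y, t) =
      (Complex ((sqrt 3 * (x - N) + y) / (2 * D)) ((sqrt 3 * y - (x - N)) / (2 * D)), t / D)"
    unfolding M_ext_def poincare_ext_def Let_def prod.case D' num det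
    by (simp add: complex_eq_iff)
qed

text \<open>The action of the inverse of \<open>M\<close> on null vectors. The coefficients come from clearing the
  denominator \<open>D\<close> when \<open>M_ext (z, t)\<close> is inserted into the equation of a sphere.\<close>

fun M_pull :: "vec \<Rightarrow> vec" where
  "M_pull (p, q, m, c) = (p + q - c + sqrt 3 * m, q,
     q - c / 2 + sqrt 3 / 2 * m, sqrt 3 / 2 * c + m / 2)"

lemma on_sph_M_ext:
  assumes "t > 0"
  shows "on_sph v (M_ext (z, t)) \<longleftrightarrow> on_sph (M_pull v) (z, t)"
proof -
  obtain p q m c where v: "v = (p, q, m, c)" by (cases v)
  obtain x y where z: "z = Complex x y" by (cases z)
  define N where "N = x\<^sup>2 + y\<^sup>2 + t\<^sup>2"
  define D where "D = 1 - 2 * x + N"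
  define X where "X = (sqrt 3 * (x - N) + y) / (2 * D)"
  define Y where "Y = (sqrt 3 * y - (x - N)) / (2 * D)"
  have M: "M_ext (z, t) = (Complex X Y, t / D)" and D: "D > 0"
    using M_ext_Complex[OF assms, of x y] by (simp_all add: z N_def D_def X_def Y_def)
  have XD: "2 * D * X = sqrt 3 * (x - N) + y" and YD: "2 * D * Y = sqrt 3 * y - (x - N)"
    and TD: "D * (t / D) = t"
    using D by (simp_all add: X_def Y_def)
  have "4 * D\<^sup>2 * (X\<^sup>2 + Y\<^sup>2 + (t / D)\<^sup>2) = (2 * D * X)\<^sup>2 + (2 * D * Y)\<^sup>2 + 4 * (D * (t / D))\<^sup>2"
    by (simp add: power2_eq_square algebra_simps)
  also have "\<dots> = (1 + (sqrt 3)\<^sup>2) * ((x - N)\<^sup>2 + y\<^sup>2) + 4 * t\<^sup>2"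
    unfolding XD YD TD by (simp add: power2_eq_square algebra_simps)
  also have "\<dots> = 4 * (N * D)"
    by (simp add: D_def N_def power2_eq_square algebra_simps)
  finally have ND: "D * (X\<^sup>2 + Y\<^sup>2 + (t / D)\<^sup>2) = N"
    using D by (simp add: power2_eq_square)
  have "on_sph v (M_ext (z, t)) \<longleftrightarrow> p * (X\<^sup>2 + Y\<^sup>2 + (t / D)\<^sup>2) - 2 * (m * X + c * Y) + q = t / D"
    by (simp add: v M)
  also have "\<dots> \<longleftrightarrow> D * (p * (X\<^sup>2 + Y\<^sup>2 + (t / D)\<^sup>2) - 2 * (m * X + c * Y) + q) = D * (t / D)"
    unfolding mult_cancel_left using D by (metis less_irrefl)
  also have "D * (p * (X\<^sup>2 + Y\<^sup>2 + (t / D)\<^sup>2) - 2 * (m * X + c * Y) + q)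
      = p * (D * (X\<^sup>2 + Y\<^sup>2 + (t / D)\<^sup>2)) - m * (2 * D * X) - c * (2 * D * Y) + q * D"
    by (simp add: algebra_simps)
  also have "\<dots> = D * (t / D) \<longleftrightarrow> on_sph (M_pull v) (z, t)"
    unfolding ND XD YD TD by (simp add: v z N_def D_def algebra_simps)
  finally show ?thesis .
qed

text \<open>Up to the rotation by \<open>\<i> cnj \<omega>\<close>, which takes \<open>u + \<i> w\<close> to the given point, \<open>M\<close> is
  \<open>z \<mapsto> z / (1 - z)\<close>, whose inverse \<open>z \<mapsto> z / (1 + z)\<close> extends to the half space by analogous
  formulas.\<close>

lemma M_ext_surj:
  assumes "snd x > 0"
  shows "\<exists>x'. snd x' > 0 \<and> M_ext x' = x"
proof -
  obtain a b s where x: "x = (Complex a b, s)" by (metis complex_surj surj_pair)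
  have s: "0 < s" using assms by (simp add: x)
  define u w where "u = (sqrt 3 * a - b) / 2" and "w = (a + sqrt 3 * b) / 2"
  define N where "N = u\<^sup>2 + w\<^sup>2 + s\<^sup>2"
  define E where "E = 1 + 2 * u + N"
  have "E = (1 + u)\<^sup>2 + w\<^sup>2 + s\<^sup>2"
    by (simp add: E_def N_def power2_eq_square algebra_simps)
  then have E: "E > 0" using s by (simp add: add_nonneg_pos)
  have N': "((u + N) / E)\<^sup>2 + (w / E)\<^sup>2 + (s / E)\<^sup>2 = N / E"
  proof -
    have "(u + N)\<^sup>2 + w\<^sup>2 + s\<^sup>2 = N * E"
      by (simp add: E_def N_def power2_eq_square algebra_simps)
    then show ?thesis using E by (simp add: power_divide power2_eq_square flip: add_divide_distrib)
  qed
  have D': "1 - 2 * ((u + N) / E) + N / E = 1 / E"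
    using E by (simp add: E_def field_simps)
  have xN: "(u + N) / E - N / E = u / E"
    by (simp add: diff_divide_distrib[symmetric])
  have "M_ext (Complex ((u + N) / E) (w / E), s / E) =
      (Complex ((sqrt 3 * (u / E) + w / E) / (2 * (1 / E)))
         ((sqrt 3 * (w / E) - u / E) / (2 * (1 / E))),
       s / E / (1 / E))"
    using M_ext_Complex(1)[of "s / E" "(u + N) / E" "w / E"] E s unfolding N' D' xN by simp
  also have "\<dots> = (Complex ((sqrt 3 * u + w) / 2) ((sqrt 3 * w - u) / 2), s)"
    using E by (simp add: field_simps)
  also have "\<dots> = x"
    by (simp add: x u_def w_def complex_eq_iff field_simps)
  finally have "M_ext (Complex ((u + N) / E) (w / E), s / E) = x" .
  moreover have "s / E > 0" using s E by simp
  ultimately show ?thesis by (metis snd_conv)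
qed

lemma M_ext_upper: "snd x > 0 \<Longrightarrow> snd (M_ext x) > 0"
  using M_ext_Complex[of "snd x" "Re (fst x)" "Im (fst x)"] by (cases x) simp

lemma sphere_image_M_pull:
  assumes "v \<in> lightcone" "M_pull v \<in> lightcone"
  shows "sphere_image M_ext (sph (M_pull v)) = sph v"
proof -
  have "M_ext ` {x. snd x > 0 \<and> on_sph (M_pull v) x} = {x. snd x > 0 \<and> on_sph v x}"
  proof (intro equalityI subsetI)
    fix x assume "x \<in> M_ext ` {x. snd x > 0 \<and> on_sph (M_pull v) x}"
    then obtain x' where x': "snd x' > 0" "on_sph (M_pull v) x'" "x = M_ext x'" by blast
    then show "x \<in> {x. snd x > 0 \<and> on_sph v x}"
      using M_ext_upper[of x'] on_sph_M_ext[of "snd x'" v "fst x'"] by simp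
  next
    fix x assume x: "x \<in> {x. snd x > 0 \<and> on_sph v x}"
    then obtain x' where x': "snd x' > 0" "M_ext x' = x" using M_ext_surj by blast
    then have "on_sph (M_pull v) x'"
      using x on_sph_M_ext[of "snd x'" v "fst x'"] by simp
    then show "x \<in> M_ext ` {x. snd x > 0 \<and> on_sph (M_pull v) x}" using x' by blast
  qed
  then show ?thesis
    unfolding sphere_image_def upper_sph[OF assms(2)]
    using closure_upper_sph[OF assms(1)] upper_sph[OF assms(1)] by simp
qed

lemma M_pull_lightcone:
  assumes "(p, q, m, c) \<in> lightcone" "p + q - c + sqrt 3 * m > 0"
  shows "M_pull (p, q, m, c) \<in> lightcone"
proof -
  have "(p + q - c + sqrt 3 * m) * q = (q - c / 2 + sqrt 3 / 2 * m)\<^sup>2 + (sqrt 3 / 2 * c + m / 2)\<^sup>2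
      + (p * q - m\<^sup>2 - c\<^sup>2)"
    by (simp add: power2_eq_square algebra_simps)
  then show ?thesis using assms by (simp add: lightcone_def)
qed

text \<open>The link between the two parametrizations: with \<open>p = a + c\<close> and \<open>q = b + c\<close>, the sphere
  \<open>\<langle>a + m / \<surd>3, b + m / \<surd>3, c + m / \<surd>3\<rangle>\<close> is sent by \<open>M\<close> to the sphere with the vector
  \<open>(p, q, m, c)\<close>. The condition \<open>m\<^sup>2 = a b + a c + b c\<close> is \<open>p q = m\<^sup>2 + c\<^sup>2\<close>.\<close>

lemma ang_eq_sph:
  assumes "a + b + c + sqrt 3 * m > 0"
  shows "ang (a + m / sqrt 3) (b + m / sqrt 3) (c + m / sqrt 3) = sph (M_pull (a + c, b + c, m, c))"
proof -
  have sqrt3: "m / sqrt 3 = sqrt 3 * m / 3"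
    by (simp add: field_simps)
  have sum: "(a + m / sqrt 3) + (b + m / sqrt 3) + (c + m / sqrt 3) = a + b + c + sqrt 3 * m"
    by (simp add: sqrt3)
  have "of_real (b + m / sqrt 3) + of_real (c + m / sqrt 3) * (1 + omega) =
      Complex (b + c / 2 + sqrt 3 / 2 * m) (sqrt 3 / 2 * c + m / 2)"
    by (simp add: complex_eq_iff omega_def sqrt3 field_simps)
  then show ?thesis
    using assms unfolding ang_def sum by (simp add: algebra_simps)
qed

text \<open>The difference \<open>(a + b + c)\<^sup>2 - 3 m\<^sup>2\<close> is half a sum of squares of differences. It
  vanishes only for \<open>a = b = c = 1\<close>, where \<open>m\<^sup>2 = 3\<close> has no integral solution.\<close>

lemma B_i_sum_pos:
  fixes a b c m :: int
  assumes "a + b + c > 0" "gcd a (gcd b c) = 1" "m\<^sup>2 = a * b + a * c + b * c"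
  shows "real_of_int (a + b + c) + sqrt 3 * m > 0"
proof -
  have sos: "2 * ((a + b + c)\<^sup>2 - 3 * m\<^sup>2) = (a - b)\<^sup>2 + (b - c)\<^sup>2 + (a - c)\<^sup>2"
    unfolding assms(3) by (simp add: power2_eq_square algebra_simps)
  have "3 * m\<^sup>2 \<noteq> (a + b + c)\<^sup>2"
  proof
    assume "3 * m\<^sup>2 = (a + b + c)\<^sup>2"
    then have "(a - b)\<^sup>2 + (b - c)\<^sup>2 + (a - c)\<^sup>2 = 0" using sos by simp
    then have "(a - b)\<^sup>2 = 0" "(b - c)\<^sup>2 = 0"
      using zero_le_power2[of "a - b"] zero_le_power2[of "b - c"] zero_le_power2[of "a - c"]
      by linarith+
    then have "a = b" "b = c" by simp_all
    with assms(1,2) have "a = 1" "b = 1" "c = 1" by simp_all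
    then have m: "m\<^sup>2 = 3" using assms(3) by simp
    have "\<bar>m\<bar> < 2"
    proof (rule ccontr)
      assume "\<not> \<bar>m\<bar> < 2"
      then have "2\<^sup>2 \<le> \<bar>m\<bar>\<^sup>2" by (intro power_mono) auto
      then show False using m by simp
    qed
    then have "m \<in> {-1, 0, 1}" by auto
    then show False using m by auto
  qed
  moreover have "0 \<le> 2 * ((a + b + c)\<^sup>2 - 3 * m\<^sup>2)"
    unfolding sos by simp
  then have "3 * m\<^sup>2 \<le> (a + b + c)\<^sup>2"
    by (simp only: zero_le_mult_iff diff_ge_0_iff_ge) simp
  ultimately have "3 * m\<^sup>2 < (a + b + c)\<^sup>2" by (metis order_less_le)
  then have "real_of_int (3 * m\<^sup>2) < real_of_int ((a + b + c)\<^sup>2)" by (simp only: of_int_less_iff)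
  then have "(sqrt 3 * m)\<^sup>2 < (real_of_int (a + b + c))\<^sup>2"
    by (simp add: power_mult_distrib)
  then have "\<bar>sqrt 3 * m\<bar> < \<bar>real_of_int (a + b + c)\<bar>"
    by (metis abs_le_square_iff not_le)
  then show ?thesis using assms(1) by linarith
qed

lemma B_i_iff:
  "X \<in> B_i \<longleftrightarrow> (\<exists>a b c m :: int. a + b + c > 0 \<and> gcd a (gcd b c) = 1 \<and> m\<^sup>2 = a * b + a * c + b * c \<and>
     X = ang (a + m / sqrt 3) (b + m / sqrt 3) (c + m / sqrt 3))" (is "_ \<longleftrightarrow> ?R")
proof
  assume "X \<in> B_i"
  then obtain a b c :: int and x :: real where abc: "gcd a (gcd b c) = 1" "a * b + a * c + b * c \<ge> 0"
      "sqrt (real_of_int (a * b + a * c + b * c)) \<in> \<int>" "a + b + c > 0"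
    and x: "x = sqrt (real_of_int (a * b + a * c + b * c)) \<or>
      x = - sqrt (real_of_int (a * b + a * c + b * c))"
    and X: "X = ang (a + x / sqrt 3) (b + x / sqrt 3) (c + x / sqrt 3)"
    unfolding B_i_def triples_def mem_Collect_eq prod.case
    by (elim exE conjE) (rule that, assumption+)
  have "x \<in> \<int>" using x abc(3) by auto
  then obtain m where m: "x = of_int m" by (auto elim: Ints_cases)
  have "x\<^sup>2 = real_of_int (a * b + a * c + b * c)"
    using x abc(2) by (auto simp del: of_int_add of_int_mult)
  then have "real_of_int (m\<^sup>2) = real_of_int (a * b + a * c + b * c)" by (simp add: m)
  then have "m\<^sup>2 = a * b + a * c + b * c" by (simp only: of_int_eq_iff)
  then show ?R
    using abc X unfolding m by (intro exI[of _ a] exI[of _ b] exI[of _ c] exI[of _ m] conjI)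
next
  assume ?R
  then obtain a b c m :: int where abc: "a + b + c > 0" "gcd a (gcd b c) = 1"
    and m: "a * b + a * c + b * c = m\<^sup>2"
    and X: "X = ang (a + m / sqrt 3) (b + m / sqrt 3) (c + m / sqrt 3)"
    by metis
  have "sqrt (real_of_int (a * b + a * c + b * c)) = \<bar>real_of_int m\<bar>"
    unfolding m by simp
  moreover have "(a, b, c) \<in> triples"
    unfolding triples_def mem_Collect_eq prod.case calculation using abc m by simp
  moreover have "real_of_int m = \<bar>real_of_int m\<bar> \<or> real_of_int m = - \<bar>real_of_int m\<bar>" by linarith
  ultimately show "X \<in> B_i"
    unfolding B_i_def mem_Collect_eq
    by (intro exI[of _ a] exI[of _ b] exI[of _ c] exI[of _ "real_of_int m"])
      (simp only: abc X simp_thms)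
qed

text \<open>From \<open>(p + q)\<^sup>2 = 4 c\<^sup>2 + 4 m\<^sup>2 + (p - q)\<^sup>2\<close> one gets \<open>\<bar>p + q\<bar> \<ge> 2 \<bar>c\<bar>\<close>, which excludes
  \<open>c < p + q \<le> 0\<close>. This is why \<open>a + b + c > 0\<close> selects the vectors on the positive half of the
  cone.\<close>

lemma definite_form_pos:
  fixes p q m c :: int
  assumes "p * q = m\<^sup>2 + c\<^sup>2" "p + q > c"
  shows "0 \<le> p" "0 \<le> q" "0 < p + q"
proof -
  have "(p + q)\<^sup>2 = (2 * c)\<^sup>2 + ((2 * m)\<^sup>2 + (p - q)\<^sup>2)"
    using assms(1) by algebra
  then have "(2 * c)\<^sup>2 \<le> (p + q)\<^sup>2" by (metis le_add_same_cancel1 sum_power2_ge_zero)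
  then have "\<bar>2 * c\<bar> \<le> \<bar>p + q\<bar>" by (simp only: abs_le_square_iff)
  then show sum: "0 < p + q" using assms(2) by linarith
  have "0 \<le> p * q" using assms(1) by simp
  then show "0 \<le> p" "0 \<le> q" using sum by (auto simp: zero_le_mult_iff)
qed

text \<open>In both directions the vector is \<open>(a + c, b + c, m, c)\<close>. Its entries are coprime exactly
  when \<open>a, b, c\<close> are: the square of a common divisor of \<open>a, b, c\<close> divides
  \<open>m\<^sup>2 = a b + a c + b c\<close>, so the divisor divides \<open>m\<close>.\<close>

lemma M_B_i_eq: "sphere_image M_ext ` B_i = sph ` prim_vecs"
proof (intro equalityI subsetI)
  fix Y assume "Y \<in> sphere_image M_ext ` B_i"
  then obtain X where X: "X \<in> B_i" "Y = sphere_image M_ext X" by blast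
  obtain a b c m :: int where abc: "a + b + c > 0" "gcd a (gcd b c) = 1" "m\<^sup>2 = a * b + a * c + b * c"
    and Y: "Y = sphere_image M_ext (ang (a + m / sqrt 3) (b + m / sqrt 3) (c + m / sqrt 3))"
    using X(1)[unfolded B_i_iff] X(2) by (elim exE conjE) (rule that, assumption+, simp)
  let ?v = "(of_int (a + c), of_int (b + c), of_int m, of_int c) :: vec"
  have pq: "(a + c) * (b + c) = m\<^sup>2 + c\<^sup>2"
    unfolding abc(3) by (simp add: power2_eq_square algebra_simps)
  have "(a + c) + (b + c) > c" using abc(1) by simp
  note nonneg = definite_form_pos[OF pq this]
  have v: "?v \<in> lightcone"
    using nonneg pq unfolding lightcone_def
    by (simp only: mem_Collect_eq prod.case of_int_0_le_iff of_int_0_less_iff simp_thms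
        flip: of_int_mult of_int_power of_int_add)
  have pos: "real_of_int a + real_of_int b + real_of_int c + sqrt 3 * m > 0"
    using B_i_sum_pos[OF abc] by simp
  have "Y = sphere_image M_ext (sph (M_pull ?v))"
    unfolding Y ang_eq_sph[OF pos] by (simp only: of_int_add)
  also have "\<dots> = sph ?v"
    using v pos by (intro sphere_image_M_pull M_pull_lightcone) (simp_all add: algebra_simps)
  finally have "Y = sph ?v" .
  moreover have "?v \<in> prim_vecs"
  proof (rule prim_vecsI[OF v refl])
    fix d assume "d dvd a + c" "d dvd b + c" "d dvd c"
    then have "d dvd gcd a (gcd b c)" by (simp add: dvd_add_left_iff)
    then show "is_unit d" by (simp only: abc(2))
  qed
  ultimately show "Y \<in> sph ` prim_vecs" by (rule image_eqI)
next
  fix Y assume "Y \<in> sph ` prim_vecs"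
  then obtain v where "v \<in> prim_vecs" and Y: "Y = sph v" by blast
  then obtain p q m c :: int where v: "v \<in> lightcone" "v = (of_int p, of_int q, of_int m, of_int c)"
    and prim: "\<forall>d. d dvd p \<longrightarrow> d dvd q \<longrightarrow> d dvd m \<longrightarrow> d dvd c \<longrightarrow> is_unit d"
    by (elim prim_vecsE)
  have "real_of_int (p * q) = real_of_int (m\<^sup>2 + c\<^sup>2)" "real_of_int (p + q) > 0"
    using v(1) by (simp_all add: v(2) lightcone_def)
  then have pq: "p * q = m\<^sup>2 + c\<^sup>2" and sum: "p + q > 0"
    by (simp_all only: of_int_eq_iff of_int_0_less_iff)
  define a b where "a = p - c" and "b = q - c"
  have "(p + q)\<^sup>2 = (2 * c)\<^sup>2 + ((2 * m)\<^sup>2 + (p - q)\<^sup>2)"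
    using pq by algebra
  then have "(2 * c)\<^sup>2 \<le> (p + q)\<^sup>2" by (metis le_add_same_cancel1 sum_power2_ge_zero)
  then have "\<bar>2 * c\<bar> \<le> \<bar>p + q\<bar>" by (simp only: abs_le_square_iff)
  then have abc: "a + b + c > 0" using sum unfolding a_def b_def by linarith
  have m: "m\<^sup>2 = a * b + a * c + b * c"
    using pq by (simp add: a_def b_def power2_eq_square algebra_simps)
  let ?g = "gcd a (gcd b c)"
  have g: "?g dvd a" "?g dvd b" "?g dvd c" by (auto intro: dvd_trans)
  then have "?g\<^sup>2 dvd m\<^sup>2"
    unfolding m unfolding power2_eq_square by (intro dvd_add mult_dvd_mono)
  then have "?g dvd m" by (simp add: pow_divides_pow_iff)
  moreover have "?g dvd a + c" "?g dvd b + c"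
    by (intro dvd_add g)+
  then have "?g dvd p" "?g dvd q" by (simp_all only: a_def b_def diff_add_cancel)
  ultimately have "is_unit ?g" using prim g(3) by blast
  then have gcd: "?g = 1" by (simp add: is_unit_gcd)
  have pos: "real_of_int a + real_of_int b + real_of_int c + sqrt 3 * m > 0"
    using B_i_sum_pos[OF abc gcd m] by simp
  have v': "v = (of_int a + of_int c, of_int b + of_int c, of_int m, of_int c)"
    by (simp add: v(2) a_def b_def)
  have "sphere_image M_ext (ang (a + m / sqrt 3) (b + m / sqrt 3) (c + m / sqrt 3)) = Y"
    unfolding ang_eq_sph[OF pos] Y v'[symmetric]
  proof (rule sphere_image_M_pull[OF v(1)])
    show "M_pull v \<in> lightcone"
      using v(1) pos unfolding v' by (intro M_pull_lightcone) (simp_all add: algebra_simps)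
  qed
  moreover have "ang (a + m / sqrt 3) (b + m / sqrt 3) (c + m / sqrt 3) \<in> B_i"
    unfolding B_i_iff
    by (intro exI[of _ a] exI[of _ b] exI[of _ c] exI[of _ m] conjI abc gcd m refl)
  ultimately show "Y \<in> sphere_image M_ext ` B_i" by blast
qed

theorem theorem5p9:
  shows "G_i = P_i \<and> P_i = sphere_image M_ext ` B_i"
  by (simp only: G_i_eq P_i_eq M_B_i_eq prim_vecs_eq_orbit simp_thms)

end
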